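(* The geometric theory $\mathbb{F}$ of finite chains is the theory obtained from the theory $\mathbb{MV}$ of MV-algebras by adding the following axiom: $$\Big(\top\vdash_x\bigvee_{k,t\in\mathbb{N}}(\exists z)(\phi_k(z)\wedge x=tz)\Big),$$ where $\phi_k(z)$ is the formula $(k-1)z=\neg z$ ($k\ge 1$).
   Context: An MV-algebra is a structure $(A,\oplus,\neg,0)$ such that $(A,\oplus,0)$ is a commutative monoid, $\neg\neg x=x$, $x\oplus\neg 0=\neg 0$ and $\neg(\neg x\oplus y)\oplus y=\neg(\neg y\oplus x)\oplus x$. Write $1=\neg 0$ and $tx=x\oplus\cdots\oplus x$ ($t$ times, with $0x=0$). $\mathbb{MV}$ is the algebraic theory of MV-algebras. For a positive integer $n$, the finite chain $S_n=\Gamma(\mathbb{Z},n)$ is the MV-algebra on $\{0,1,\dots,n\}$ with $x\oplus y=\min(x+y,n)$ and $\neg x=n-x$. A geometric sequent is $(\phi\vdash_{\vec x}\psi)$ with $\phi,\psi$ built from atomic formulae using finitary conjunctions, existential quantifications and arbitrary disjunctions; provability is in geometric logic. $\mathbb{F}$ is the geometric theory consisting of all the geometric sequents over the signature of $\mathbb{MV}$ which are satisfied in every finite chain. Saying that $\mathbb{F}$ is the theory obtained from $\mathbb{MV}$ by adding the axiom means that the two theories prove the same geometric sequents over this signature.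
   Formalization: With finite chains S_n for n ≥ 1 the claim fails: 0=1 ⊢ ⊥ holds in each but the one-element MV-algebra satisfies MV and the axiom. Proved instead: the claim with S_0 counted as a finite chain, and, for n ≥ 1, with the sequent 0=1 ⊢ ⊥ added to the axioms. *)

theory Defs
  imports Main
begin

section \<open>Geometric formulae over the signature of MV-algebras\<close>

text \<open>
  Variables are de Bruijn indices.  A context is a number \<open>n\<close>, standing for the variables
  \<open>Var 0, \<dots>, Var (n - 1)\<close>; \<open>Ex\<close> binds \<open>Var 0\<close> and shifts the others.
\<close>

datatype trm = Var nat | Zero | Neg trm | Plus trm trm

abbreviation One :: trm where "One \<equiv> Neg Zero"

fun multiple :: "nat \<Rightarrow> trm \<Rightarrow> trm" where
  "multiple 0 x = Zero"
| "multiple (Suc 0) x = x"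
| "multiple (Suc (Suc t)) x = Plus (multiple (Suc t) x) x"

text \<open>
  A datatype cannot have disjunctions over index sets of unbounded cardinality, so the type of
  indices is a parameter \<open>'j\<close>: \<open>Disj I F\<close> is the disjunction of the \<open>F i\<close> for \<open>i \<in> I\<close>, where
  \<open>I :: 'j set\<close> may be empty.  Results about arbitrary disjunctions are stated for all \<open>'j\<close> that
  are large enough to express the sequents of interest.
\<close>

datatype 'j form =
    Eq trm trm
  | Tru
  | And "'j form" "'j form"
  | Disj "'j set" "'j \<Rightarrow> 'j form"
  | Ex "'j form"

definition Fls :: "'j form" where
  "Fls = Disj {} (\<lambda>_. Tru)"

primrec wf_trm :: "nat \<Rightarrow> trm \<Rightarrow> bool" where
  "wf_trm n (Var i) \<longleftrightarrow> i < n"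
| "wf_trm n Zero \<longleftrightarrow> True"
| "wf_trm n (Neg s) \<longleftrightarrow> wf_trm n s"
| "wf_trm n (Plus s t) \<longleftrightarrow> wf_trm n s \<and> wf_trm n t"

primrec wf_form :: "'j form \<Rightarrow> nat \<Rightarrow> bool" where
  "wf_form (Eq s t) n \<longleftrightarrow> wf_trm n s \<and> wf_trm n t"
| "wf_form Tru n \<longleftrightarrow> True"
| "wf_form (And \<phi> \<psi>) n \<longleftrightarrow> wf_form \<phi> n \<and> wf_form \<psi> n"
| "wf_form (Disj I F) n \<longleftrightarrow> (\<forall>i\<in>I. wf_form (F i) n)"
| "wf_form (Ex \<phi>) n \<longleftrightarrow> wf_form \<phi> (Suc n)"

text \<open>\<open>Sequent n \<phi> \<psi>\<close> is the sequent from \<open>\<phi>\<close> to \<open>\<psi>\<close> in the context \<open>n\<close>.\<close>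

datatype 'j sequent = Sequent nat "'j form" "'j form"

primrec wf_sequent :: "'j sequent \<Rightarrow> bool" where
  "wf_sequent (Sequent n \<phi> \<psi>) \<longleftrightarrow> wf_form \<phi> n \<and> wf_form \<psi> n"

primrec subst_trm :: "(nat \<Rightarrow> trm) \<Rightarrow> trm \<Rightarrow> trm" where
  "subst_trm \<sigma> (Var i) = \<sigma> i"
| "subst_trm \<sigma> Zero = Zero"
| "subst_trm \<sigma> (Neg s) = Neg (subst_trm \<sigma> s)"
| "subst_trm \<sigma> (Plus s t) = Plus (subst_trm \<sigma> s) (subst_trm \<sigma> t)"

definition under_binder :: "(nat \<Rightarrow> trm) \<Rightarrow> nat \<Rightarrow> trm" where
  "under_binder \<sigma> i = (case i of 0 \<Rightarrow> Var 0 | Suc j \<Rightarrow> subst_trm (\<lambda>k. Var (Suc k)) (\<sigma> j))"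

primrec subst :: "'j form \<Rightarrow> (nat \<Rightarrow> trm) \<Rightarrow> 'j form" where
  "subst (Eq s t) \<sigma> = Eq (subst_trm \<sigma> s) (subst_trm \<sigma> t)"
| "subst Tru \<sigma> = Tru"
| "subst (And \<phi> \<psi>) \<sigma> = And (subst \<phi> \<sigma>) (subst \<psi> \<sigma>)"
| "subst (Disj I F) \<sigma> = Disj I (\<lambda>i. subst (F i) \<sigma>)"
| "subst (Ex \<phi>) \<sigma> = Ex (subst \<phi> (under_binder \<sigma>))"

abbreviation weaken :: "'j form \<Rightarrow> 'j form" where
  "weaken \<phi> \<equiv> subst \<phi> (\<lambda>i. Var (Suc i))"


section \<open>Provability in geometric logic\<close>

text \<open>
  The sequent calculus of Johnstone, Sketches of an Elephant, D1.3.1.  The equality rule is given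
  for the replacement of one variable by another; simultaneous replacement follows by iterating it.
\<close>

inductive proves :: "'j sequent set \<Rightarrow> 'j sequent \<Rightarrow> bool" for T :: "'j sequent set" where
  axiom: "s \<in> T \<Longrightarrow> wf_sequent s \<Longrightarrow> proves T s"
| identity: "wf_form \<phi> n \<Longrightarrow> proves T (Sequent n \<phi> \<phi>)"
| substitution: "proves T (Sequent n \<phi> \<psi>) \<Longrightarrow> (\<And>i. i < n \<Longrightarrow> wf_trm m (\<sigma> i)) \<Longrightarrow>
    proves T (Sequent m (subst \<phi> \<sigma>) (subst \<psi> \<sigma>))"
| cut: "proves T (Sequent n \<phi> \<psi>) \<Longrightarrow> proves T (Sequent n \<psi> \<chi>) \<Longrightarrow> proves T (Sequent n \<phi> \<chi>)"
| eq_refl: "proves T (Sequent 1 Tru (Eq (Var 0) (Var 0)))"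
| eq_replace: "wf_form \<phi> n \<Longrightarrow> i < n \<Longrightarrow> j < n \<Longrightarrow>
    proves T (Sequent n (And (Eq (Var i) (Var j)) \<phi>) (subst \<phi> (Var(i := Var j))))"
| truth: "wf_form \<phi> n \<Longrightarrow> proves T (Sequent n \<phi> Tru)"
| and_left1: "wf_form \<phi> n \<Longrightarrow> wf_form \<psi> n \<Longrightarrow> proves T (Sequent n (And \<phi> \<psi>) \<phi>)"
| and_left2: "wf_form \<phi> n \<Longrightarrow> wf_form \<psi> n \<Longrightarrow> proves T (Sequent n (And \<phi> \<psi>) \<psi>)"
| and_right: "proves T (Sequent n \<phi> \<psi>) \<Longrightarrow> proves T (Sequent n \<phi> \<chi>) \<Longrightarrow>
    proves T (Sequent n \<phi> (And \<psi> \<chi>))"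
| disj_right: "wf_form (Disj I F) n \<Longrightarrow> i \<in> I \<Longrightarrow> proves T (Sequent n (F i) (Disj I F))"
| disj_left: "wf_form (Disj I F) n \<Longrightarrow> wf_form \<chi> n \<Longrightarrow>
    (\<And>i. i \<in> I \<Longrightarrow> proves T (Sequent n (F i) \<chi>)) \<Longrightarrow> proves T (Sequent n (Disj I F) \<chi>)"
| ex_left: "wf_form \<psi> n \<Longrightarrow> proves T (Sequent (Suc n) \<phi> (weaken \<psi>)) \<Longrightarrow>
    proves T (Sequent n (Ex \<phi>) \<psi>)"
| ex_right: "proves T (Sequent n (Ex \<phi>) \<psi>) \<Longrightarrow> proves T (Sequent (Suc n) \<phi> (weaken \<psi>))"
| distributivity: "wf_form \<phi> n \<Longrightarrow> wf_form (Disj I F) n \<Longrightarrow>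
    proves T (Sequent n (And \<phi> (Disj I F)) (Disj I (\<lambda>i. And \<phi> (F i))))"
| frobenius: "wf_form \<phi> n \<Longrightarrow> wf_form (Ex \<psi>) n \<Longrightarrow>
    proves T (Sequent n (And \<phi> (Ex \<psi>)) (Ex (And (weaken \<phi>) \<psi>)))"

definition same_theorems :: "'j sequent set \<Rightarrow> 'j sequent set \<Rightarrow> bool" where
  "same_theorems T U \<longleftrightarrow> (\<forall>s. wf_sequent s \<longrightarrow> (proves T s \<longleftrightarrow> proves U s))"


section \<open>Structures and satisfaction\<close>

record 'a mv_structure =
  universe :: "'a set"
  mv_plus :: "'a \<Rightarrow> 'a \<Rightarrow> 'a"
  mv_neg :: "'a \<Rightarrow> 'a"
  mv_zero :: 'a

primrec eval_trm :: "'a mv_structure \<Rightarrow> (nat \<Rightarrow> 'a) \<Rightarrow> trm \<Rightarrow> 'a" where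
  "eval_trm M e (Var i) = e i"
| "eval_trm M e Zero = mv_zero M"
| "eval_trm M e (Neg s) = mv_neg M (eval_trm M e s)"
| "eval_trm M e (Plus s t) = mv_plus M (eval_trm M e s) (eval_trm M e t)"

primrec sat :: "'a mv_structure \<Rightarrow> 'j form \<Rightarrow> (nat \<Rightarrow> 'a) \<Rightarrow> bool" where
  "sat M (Eq s t) e \<longleftrightarrow> eval_trm M e s = eval_trm M e t"
| "sat M Tru e \<longleftrightarrow> True"
| "sat M (And \<phi> \<psi>) e \<longleftrightarrow> sat M \<phi> e \<and> sat M \<psi> e"
| "sat M (Disj I F) e \<longleftrightarrow> (\<exists>i\<in>I. sat M (F i) e)"
| "sat M (Ex \<phi>) e \<longleftrightarrow> (\<exists>a\<in>universe M. sat M \<phi> (case_nat a e))"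

primrec satisfies :: "'a mv_structure \<Rightarrow> 'j sequent \<Rightarrow> bool" where
  "satisfies M (Sequent n \<phi> \<psi>) \<longleftrightarrow>
    (\<forall>e. (\<forall>i<n. e i \<in> universe M) \<longrightarrow> sat M \<phi> e \<longrightarrow> sat M \<psi> e)"


section \<open>The theories\<close>

definition MV :: "'j sequent set" where
  "MV = (let x = Var 0; y = Var 1; z = Var 2 in
    {Sequent 3 Tru (Eq (Plus x (Plus y z)) (Plus (Plus x y) z)),
     Sequent 2 Tru (Eq (Plus x y) (Plus y x)),
     Sequent 1 Tru (Eq (Plus x Zero) x),
     Sequent 1 Tru (Eq (Neg (Neg x)) x),
     Sequent 1 Tru (Eq (Plus x One) One),
     Sequent 2 Tru (Eq (Plus (Neg (Plus (Neg x) y)) y) (Plus (Neg (Plus (Neg y) x)) x))})"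

definition \<phi>\<^sub>k :: "nat \<Rightarrow> trm \<Rightarrow> 'j form" where
  "\<phi>\<^sub>k k z = Eq (multiple (k - 1) z) (Neg z)"

text \<open>
  The disjunction over pairs \<open>(k, t)\<close> needs \<open>\<nat> \<times> \<nat>\<close> among the indices.  As \<open>'i\<close> varies, the type
  \<open>(nat \<times> nat) + 'i\<close> takes every infinite cardinality.  Below \<open>Ex\<close>, \<open>Var 0\<close> is \<open>z\<close> and
  \<open>Var 1\<close> is \<open>x\<close>.
\<close>

definition chain_axiom :: "((nat \<times> nat) + 'i) sequent" where
  "chain_axiom = Sequent 1 Tru
    (Disj (Inl ` {(k, t). k \<ge> 1})
      (\<lambda>i. case i of
          Inl (k, t) \<Rightarrow> Ex (And (\<phi>\<^sub>k k (Var 0)) (Eq (Var 1) (multiple t (Var 0))))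
        | Inr _ \<Rightarrow> Fls))"

definition nontriviality :: "'j sequent" where
  "nontriviality = Sequent 0 (Eq Zero One) Fls"

definition chain :: "nat \<Rightarrow> nat mv_structure" where
  "chain n = \<lparr>universe = {0..n}, mv_plus = (\<lambda>x y. min (x + y) n), mv_neg = (\<lambda>x. n - x), mv_zero = 0\<rparr>"

definition theory_of_chains :: "nat set \<Rightarrow> 'j sequent set" where
  "theory_of_chains N = {s. wf_sequent s \<and> (\<forall>n\<in>N. satisfies (chain n) s)}"

text \<open>
  The theory of finite chains is \<open>theory_of_chains UNIV\<close>, where the one-element chain \<open>chain 0\<close> counts
  as a finite chain, or \<open>theory_of_chains {0<..}\<close>, where it does not.  The two differ:
  \<open>nontriviality\<close> belongs to the second one only.  It is not provable from \<open>MV\<close> and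
  \<open>chain_axiom\<close>, since \<open>chain 0\<close> is a model of these, so an axiomatisation of the second theory needs it
  as a further axiom.
\<close>

lemma eval_subst_trm: "eval_trm M e (subst_trm \<sigma> s) = eval_trm M (\<lambda>i. eval_trm M e (\<sigma> i)) s"
  by (induction s) auto

lemma sat_subst: "sat M (subst \<phi> \<sigma>) e \<longleftrightarrow> sat M \<phi> (\<lambda>i. eval_trm M e (\<sigma> i))"
proof (induction \<phi> arbitrary: \<sigma> e)
  case (Ex \<phi>)
  have "(\<lambda>i. eval_trm M (case_nat a e) (under_binder \<sigma> i)) =
      case_nat a (\<lambda>i. eval_trm M e (\<sigma> i))" for a
    by (auto simp: under_binder_def eval_subst_trm split: nat.split)
  then show ?case using Ex by simp
qed (auto simp: eval_subst_trm)

lemma eval_closed: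
  assumes "mv_zero M \<in> universe M" "\<And>a. a \<in> universe M \<Longrightarrow> mv_neg M a \<in> universe M"
    "\<And>a b. a \<in> universe M \<Longrightarrow> b \<in> universe M \<Longrightarrow> mv_plus M a b \<in> universe M"
    "\<forall>i<n. e i \<in> universe M" "wf_trm n s"
  shows "eval_trm M e s \<in> universe M"
  using assms(5) by (induction s) (use assms(1-4) in auto)

lemma soundness:
  assumes "proves T s" "\<And>s. s \<in> T \<Longrightarrow> satisfies M s"
    and closed: "mv_zero M \<in> universe M" "\<And>a. a \<in> universe M \<Longrightarrow> mv_neg M a \<in> universe M"
    "\<And>a b. a \<in> universe M \<Longrightarrow> b \<in> universe M \<Longrightarrow> mv_plus M a b \<in> universe M"
  shows "satisfies M s"
  using assms(1)
proof (induction rule: proves.induct)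
  case (axiom s)
  then show ?case using assms(2) by blast
next
  case (substitution n \<phi> \<psi> m \<sigma>)
  then show ?case using eval_closed[OF closed, of m] by (simp add: sat_subst)
next
  case (eq_replace \<phi> n i j)
  have "(\<lambda>k. eval_trm M e ((Var(i := Var j)) k)) = e" if "e i = e j" for e :: "nat \<Rightarrow> 'b"
    using that by auto
  then show ?case by (simp add: sat_subst del: fun_upd_apply)
next
  case (ex_left \<psi> n \<phi>)
  show ?case
    unfolding satisfies.simps sat.simps
  proof (intro allI impI, elim bexE)
    fix e a assume e: "\<forall>i<n. e i \<in> universe M" "a \<in> universe M" "sat M \<phi> (case_nat a e)"
    then have "\<forall>i<Suc n. case_nat a e i \<in> universe M" by (auto split: nat.split)
    with e(3) ex_left have "sat M (weaken \<psi>) (case_nat a e)" by simp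
    then show "sat M \<psi> e" by (simp add: sat_subst)
  qed
next
  case (ex_right n \<phi> \<psi>)
  show ?case
    unfolding satisfies.simps
  proof (intro allI impI)
    fix e assume e: "\<forall>i<Suc n. e i \<in> universe M" "sat M \<phi> e"
    have "case_nat (e 0) (\<lambda>i. e (Suc i)) = e" by (auto split: nat.split)
    then have "sat M (Ex \<phi>) (\<lambda>i. e (Suc i))" using e by (auto intro!: bexI[of _ "e 0"])
    moreover have "\<forall>i<n. e (Suc i) \<in> universe M" using e by simp
    ultimately show "sat M (weaken \<psi>) e" using ex_right by (simp add: sat_subst)
  qed
qed (auto simp: sat_subst)

lemma nontriviality_in_theory: "nontriviality \<in> theory_of_chains {0<..}"
  by (auto simp: nontriviality_def theory_of_chains_def chain_def Fls_def)

lemma nontriviality_not_provable: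
  "\<not> proves (MV \<union> {chain_axiom}) (nontriviality :: ((nat \<times> nat) + 'a) sequent)"
proof
  assume "proves (MV \<union> {chain_axiom}) (nontriviality :: ((nat \<times> nat) + 'a) sequent)"
  then have "satisfies (chain 0) (nontriviality :: ((nat \<times> nat) + 'a) sequent)"
  proof (rule soundness)
    fix s :: "((nat \<times> nat) + 'a) sequent" assume "s \<in> MV \<union> {chain_axiom}"
    moreover have "eval_trm (chain 0) e (multiple t (Var 0)) = 0" if "e 0 = 0" for e t
      using that by (induction t "Var 0" rule: multiple.induct) (auto simp: chain_def)
    ultimately show "satisfies (chain 0) s"
      by (auto simp: MV_def Let_def chain_axiom_def \<phi>\<^sub>k_def chain_def)
  qed (auto simp: chain_def)
  then show False by (auto simp: nontriviality_def chain_def Fls_def)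
qed

end

theory Submission
  imports Defs
begin

text \<open>
  Let \<open>T\<close> be one of the two axiomatisations.  Its axioms hold in the chains concerned, so by soundness the
  point is completeness: a geometric sequent that holds in all these chains is provable from \<open>T\<close>.

  For \<open>k \<ge> 1\<close>, an element \<open>z\<close> with \<open>(k - 1) z = \<not> z\<close> is the same thing as a homomorphism from \<open>chain k\<close>,
  sending \<open>j\<close> to \<open>j z\<close> (\<open>generator_mult_hom\<close>).  The chain axiom says that each single element lies in
  the image of such a homomorphism.  Finitely many elements then lie in the image of a common one, because two such
  images, of \<open>chain k\<close> and \<open>chain l\<close>, always lie inside the image of one \<open>chain m\<close>
  (\<open>generator_common\<close>).  This last fact holds in every MV-algebra: \<open>k z = 1 = l w\<close> makes \<open>z\<close> and \<open>w\<close>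
  commensurable, and the subtractive Euclidean algorithm finds a common measure (\<open>common_measure\<close>).

  It follows by induction on \<open>\<phi>\<close> that a tuple satisfying a formula \<open>\<phi>\<close> comes from a tuple satisfying
  \<open>\<phi>\<close> in a finite chain: the sequent from \<open>\<phi> x\<close> to the disjunction, over all \<open>k\<close> and all tuples
  \<open>t\<close> of elements of \<open>chain k\<close> satisfying \<open>\<phi>\<close>, of ``\<open>x = t z\<close> for some \<open>z\<close> that generates an image of \<open>chain k\<close>'' is derivable
  (\<open>locally_sat_chain\<close>).  If the sequent from \<open>\<phi>\<close> to \<open>\<psi>\<close> holds in all chains, then \<open>t\<close> also satisfies
  \<open>\<psi>\<close> in \<open>chain k\<close>; geometric formulae are preserved by homomorphisms, so \<open>\<psi> x\<close> follows.

  Infinitary geometric logic has no completeness theorem for set-valued models, so this argument has to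
  be carried out inside the sequent calculus.  Equational reasoning is done in the term models
  \<open>term_model n \<gamma>\<close>, the algebras of terms in the context \<open>n\<close> modulo provable equality under the hypothesis
  \<open>\<gamma>\<close>; these are genuine MV-algebras.  Case distinctions and the choice of witnesses are done by passing to
  further hypotheses and larger contexts, in the style of Kripke--Joyal semantics: \<open>locally n \<gamma> Q\<close> says
  that \<open>Q\<close> may be assumed when something is to be derived from \<open>\<gamma>\<close>.

  The one-element algebra needs care: it is a quotient of every chain, so an equation true in a model
  of \<open>T\<close> need not hold in the chain that the elements come from.  The index \<open>k = 0\<close> stands for this
  case, and \<open>chain 0\<close> is exactly the one-element algebra.  This is where the two theories in the
  theorem part: the second one refutes the case \<open>k = 0\<close> by \<open>nontriviality\<close>.
\<close>

section \<open>MV-algebras\<close>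

locale mv_algebra =
  fixes M :: "'a mv_structure"
  assumes zero_closed [simp]: "mv_zero M \<in> universe M"
    and neg_closed [simp]: "x \<in> universe M \<Longrightarrow> mv_neg M x \<in> universe M"
    and plus_closed [simp]: "x \<in> universe M \<Longrightarrow> y \<in> universe M \<Longrightarrow> mv_plus M x y \<in> universe M"
    and assoc: "x \<in> universe M \<Longrightarrow> y \<in> universe M \<Longrightarrow> z \<in> universe M \<Longrightarrow>
      mv_plus M (mv_plus M x y) z = mv_plus M x (mv_plus M y z)"
    and commute: "x \<in> universe M \<Longrightarrow> y \<in> universe M \<Longrightarrow> mv_plus M x y = mv_plus M y x"
    and plus_zero [simp]: "x \<in> universe M \<Longrightarrow> mv_plus M x (mv_zero M) = x"
    and neg_neg [simp]: "x \<in> universe M \<Longrightarrow> mv_neg M (mv_neg M x) = x"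
    and plus_one [simp]: "x \<in> universe M \<Longrightarrow>
      mv_plus M x (mv_neg M (mv_zero M)) = mv_neg M (mv_zero M)"
    and lukasiewicz: "x \<in> universe M \<Longrightarrow> y \<in> universe M \<Longrightarrow>
      mv_plus M (mv_neg M (mv_plus M (mv_neg M x) y)) y =
      mv_plus M (mv_neg M (mv_plus M (mv_neg M y) x)) x"

text \<open>
  Unlike \<open>multiple\<close>, this satisfies one uniform recursion; the two agree on elements of an
  MV-algebra (\<open>eval_multiple\<close>).
\<close>
primrec mult :: "'a mv_structure \<Rightarrow> nat \<Rightarrow> 'a \<Rightarrow> 'a" where
  "mult M 0 x = mv_zero M"
| "mult M (Suc t) x = mv_plus M (mult M t x) x"

text \<open>
  For \<open>k \<ge> 1\<close> this is the interpretation of the formula \<open>\<phi>\<^sub>k\<close>.  The clause for \<open>k = 0\<close> is chosen so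
  that generators always correspond to homomorphisms from \<open>chain k\<close>: there is one from the one-element
  algebra \<open>chain 0\<close> exactly if \<open>0 = 1\<close>.
\<close>
definition generator :: "'a mv_structure \<Rightarrow> nat \<Rightarrow> 'a \<Rightarrow> bool" where
  "generator M k z \<longleftrightarrow> z \<in> universe M \<and>
    (if k = 0 then mv_zero M = mv_neg M (mv_zero M) else mult M (k - 1) z = mv_neg M z)"

definition mv_hom :: "'a mv_structure \<Rightarrow> 'b mv_structure \<Rightarrow> ('a \<Rightarrow> 'b) \<Rightarrow> bool" where
  "mv_hom M N f \<longleftrightarrow> mv_algebra M \<and> mv_algebra N \<and> f ` universe M \<subseteq> universe N
    \<and> f (mv_zero M) = mv_zero N
    \<and> (\<forall>x\<in>universe M. f (mv_neg M x) = mv_neg N (f x))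
    \<and> (\<forall>x\<in>universe M. \<forall>y\<in>universe M. f (mv_plus M x y) = mv_plus N (f x) (f y))"

context mv_algebra
begin

abbreviation carrier ("A") where "A \<equiv> universe M"
abbreviation plus (infixl "\<oplus>" 65) where "x \<oplus> y \<equiv> mv_plus M x y"
abbreviation neg ("\<sim> _" [81] 80) where "\<sim> x \<equiv> mv_neg M x"
abbreviation zero ("\<zero>") where "\<zero> \<equiv> mv_zero M"
abbreviation one ("\<one>") where "\<one> \<equiv> \<sim> \<zero>"
abbreviation minus (infixl "\<ominus>" 65) where "x \<ominus> y \<equiv> \<sim> (\<sim> x \<oplus> y)"
abbreviation mtimes (infixr "\<cdot>" 70) where "t \<cdot> x \<equiv> mult M t x"

abbreviation le (infix "\<preceq>" 50) where "x \<preceq> y \<equiv> \<sim> x \<oplus> y = \<one>"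
abbreviation orth (infix "\<bottom>" 50) where "x \<bottom> y \<equiv> x \<preceq> \<sim> y"

lemma left_commute: "x \<in> A \<Longrightarrow> y \<in> A \<Longrightarrow> z \<in> A \<Longrightarrow> x \<oplus> (y \<oplus> z) = y \<oplus> (x \<oplus> z)"
  by (metis assoc commute)

lemmas ac = assoc commute left_commute

lemma zero_plus [simp]: "x \<in> A \<Longrightarrow> \<zero> \<oplus> x = x"
  by (metis commute plus_zero zero_closed)

lemma one_plus [simp]: "x \<in> A \<Longrightarrow> \<one> \<oplus> x = \<one>"
  by (metis commute plus_one zero_closed neg_closed)

lemma le_refl [simp]: "x \<in> A \<Longrightarrow> x \<preceq> x"
  using lukasiewicz[of x \<one>] by simp

lemma plus_neg [simp]: "x \<in> A \<Longrightarrow> x \<oplus> \<sim> x = \<one>"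
  by (subst commute) auto

text \<open>
  The order is the algebraic order of the monoid, which makes transitivity and monotonicity
  immediate.
\<close>
lemma le_iff: 
  assumes "x \<in> A" "y \<in> A" shows "x \<preceq> y \<longleftrightarrow> (\<exists>c\<in>A. y = x \<oplus> c)"
proof
  assume "x \<preceq> y"
  then have "y = x \<oplus> (y \<ominus> x)" using lukasiewicz[of x y] assms by (simp add: commute)
  moreover have "y \<ominus> x \<in> A" using assms by simp
  ultimately show "\<exists>c\<in>A. y = x \<oplus> c" ..
next
  assume "\<exists>c\<in>A. y = x \<oplus> c"
  then obtain c where "c \<in> A" "y = x \<oplus> c" ..
  then show "x \<preceq> y" using assms by (simp flip: assoc)
qed

lemma le_plus [simp]: "x \<in> A \<Longrightarrow> y \<in> A \<Longrightarrow> x \<preceq> x \<oplus> y"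
  by (subst le_iff) auto

lemma le_plus2 [simp]: "x \<in> A \<Longrightarrow> y \<in> A \<Longrightarrow> y \<preceq> x \<oplus> y"
  by (subst le_iff) (auto simp: commute)

lemma le_trans:
  assumes "x \<preceq> y" "y \<preceq> z" "x \<in> A" "y \<in> A" "z \<in> A" shows "x \<preceq> z"
proof -
  obtain c d where "c \<in> A" "d \<in> A" "y = x \<oplus> c" "z = y \<oplus> d" using assms le_iff by metis
  then show ?thesis using assms by (simp add: assoc)
qed

lemma minus_plus: "x \<preceq> y \<Longrightarrow> x \<in> A \<Longrightarrow> y \<in> A \<Longrightarrow> (y \<ominus> x) \<oplus> x = y"
  using lukasiewicz[of x y] by simp

lemma le_antisym: "x \<preceq> y \<Longrightarrow> y \<preceq> x \<Longrightarrow> x \<in> A \<Longrightarrow> y \<in> A \<Longrightarrow> x = y"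
  using minus_plus[of x y] by simp

lemma plus_mono:
  assumes "x \<preceq> x'" "y \<preceq> y'" "x \<in> A" "y \<in> A" "x' \<in> A" "y' \<in> A"
  shows "x \<oplus> y \<preceq> x' \<oplus> y'"
proof -
  obtain c d where "c \<in> A" "d \<in> A" "x' = x \<oplus> c" "y' = y \<oplus> d" using assms le_iff by metis
  then have "x' \<oplus> y' = (x \<oplus> y) \<oplus> (c \<oplus> d)" using assms by (simp add: ac)
  then show ?thesis using assms \<open>c \<in> A\<close> \<open>d \<in> A\<close> by simp
qed

lemma neg_antimono: "x \<preceq> y \<Longrightarrow> x \<in> A \<Longrightarrow> y \<in> A \<Longrightarrow> \<sim> y \<preceq> \<sim> x"
  by (simp add: commute)

lemma le_zero: "x \<preceq> \<zero> \<Longrightarrow> x \<in> A \<Longrightarrow> x = \<zero>"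
  using le_antisym[of x \<zero>] by simp

lemma minus_le_iff: "x \<in> A \<Longrightarrow> y \<in> A \<Longrightarrow> z \<in> A \<Longrightarrow> x \<ominus> y \<preceq> z \<longleftrightarrow> x \<preceq> y \<oplus> z"
  by (simp add: assoc)

lemma minus_mono:
  "x \<preceq> x' \<Longrightarrow> y' \<preceq> y \<Longrightarrow> x \<in> A \<Longrightarrow> y \<in> A \<Longrightarrow> x' \<in> A \<Longrightarrow> y' \<in> A \<Longrightarrow> x \<ominus> y \<preceq> x' \<ominus> y'"
  by (intro neg_antimono plus_mono) auto

lemma minus_le: "x \<in> A \<Longrightarrow> y \<in> A \<Longrightarrow> x \<ominus> y \<preceq> x"
  by (subst minus_le_iff) auto

lemma orth_sym: "x \<bottom> y \<Longrightarrow> x \<in> A \<Longrightarrow> y \<in> A \<Longrightarrow> y \<bottom> x"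
  by (simp add: commute)

text \<open>
  Orthogonal elements are those whose sum is not truncated.  This is the point where the Lukasiewicz
  law gives cancellation for such sums; together with \<open>orth_assoc\<close> it lets one compute with orthogonal
  sums as in the positive cone of an ordered group.
\<close>
lemma plus_minus:
  assumes "x \<bottom> y" "x \<in> A" "y \<in> A" shows "(x \<oplus> y) \<ominus> y = x"
  using lukasiewicz[of "\<sim> x" y] assms by (simp add: commute)

lemma orth_cancel:
  "x \<oplus> y = x' \<oplus> y \<Longrightarrow> x \<bottom> y \<Longrightarrow> x' \<bottom> y \<Longrightarrow> x \<in> A \<Longrightarrow> x' \<in> A \<Longrightarrow> y \<in> A \<Longrightarrow> x = x'"
  using plus_minus by metis

lemma orth_mono:
  "x \<bottom> y \<Longrightarrow> x' \<preceq> x \<Longrightarrow> y' \<preceq> y \<Longrightarrow> x \<in> A \<Longrightarrow> y \<in> A \<Longrightarrow> x' \<in> A \<Longrightarrow> y' \<in> A \<Longrightarrow> x' \<bottom> y'"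
  by (meson le_trans neg_antimono neg_closed)

lemma orth_assoc:
  assumes "x \<bottom> y" "x \<oplus> y \<bottom> z" "x \<in> A" "y \<in> A" "z \<in> A"
  shows "y \<bottom> z" "x \<bottom> y \<oplus> z"
proof -
  show "y \<bottom> z" using assms by (intro orth_mono[OF assms(2)]) auto
  have "(x \<oplus> y) \<ominus> y \<preceq> \<sim> z \<ominus> y" using assms by (intro minus_mono) auto
  then show "x \<bottom> y \<oplus> z" using assms plus_minus[of x y] commute[of y z] by simp
qed

lemma sup_least:
  assumes "x \<preceq> c" "y \<preceq> c" "x \<in> A" "y \<in> A" "c \<in> A" shows "(x \<ominus> y) \<oplus> y \<preceq> c"
proof -
  have "(x \<ominus> y) \<oplus> y \<preceq> (c \<ominus> y) \<oplus> y" using assms by (intro plus_mono minus_mono) auto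
  then show ?thesis using minus_plus[of y c] assms by simp
qed

lemma sup_ge: "x \<in> A \<Longrightarrow> y \<in> A \<Longrightarrow> x \<preceq> (x \<ominus> y) \<oplus> y"
  by (subst lukasiewicz) auto

text \<open>
  Let \<open>j\<close> be the join of \<open>x\<close> and \<open>y\<close>.  Both \<open>x \<oplus> u\<close> and \<open>y \<oplus> u\<close> stay below \<open>j\<close>, hence so does
  \<open>j \<oplus> u\<close>, although \<open>u\<close> is orthogonal to \<open>j\<close>; cancelling \<open>j\<close> leaves \<open>u = \<zero>\<close>.
\<close>
lemma differences_disjoint:
  assumes "u \<preceq> x \<ominus> y" "u \<preceq> y \<ominus> x" and A: "x \<in> A" "y \<in> A" "u \<in> A"
  shows "u = \<zero>"
proof -
  define j where "j = (x \<ominus> y) \<oplus> y"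
  have j: "j \<in> A" "j = (y \<ominus> x) \<oplus> x" using A lukasiewicz by (auto simp: j_def)
  have xj: "x \<preceq> j" "y \<preceq> j" using A by (auto simp: j_def sup_ge)
  have ux: "x \<bottom> u"
    using assms orth_sym[of u x] le_trans[of u "y \<ominus> x" "\<sim> x"] by (simp add: commute)
  have uy: "y \<bottom> u"
    using assms orth_sym[of u y] le_trans[of u "x \<ominus> y" "\<sim> y"] by (simp add: commute)
  have "x \<oplus> u \<preceq> j" unfolding j(2) using assms by (subst commute[of x]) (auto intro!: plus_mono)
  moreover have "y \<oplus> u \<preceq> j" unfolding j_def using assms by (subst commute[of y]) (auto intro!: plus_mono)
  ultimately have "(x \<oplus> u) \<ominus> u \<preceq> j \<ominus> u" "(y \<oplus> u) \<ominus> u \<preceq> j \<ominus> u"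
    using A j(1) by (intro minus_mono; simp)+
  then have "x \<preceq> j \<ominus> u" "y \<preceq> j \<ominus> u" using plus_minus ux uy A by auto
  then have "j \<preceq> j \<ominus> u" unfolding j_def using A by (intro sup_least) auto
  then have "j \<oplus> u \<preceq> (j \<ominus> u) \<oplus> u" using A j by (intro plus_mono) auto
  moreover have "u \<preceq> j"
    by (rule le_trans[OF assms(1)], rule le_trans[of _ x]) (use A j xj minus_le in auto)
  ultimately have "j \<oplus> u \<preceq> j" using minus_plus A j by simp
  then have *: "u \<oplus> j = \<zero> \<oplus> j" using A j le_antisym[of "j \<oplus> u" j] by (simp add: commute)
  have "j \<bottom> u" unfolding j_def using ux uy A by (intro sup_least) auto
  then show ?thesis using orth_cancel[OF *] A j orth_sym by simp
qed

lemma mult_closed [simp]: "x \<in> A \<Longrightarrow> t \<cdot> x \<in> A"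
  by (induction t) auto

lemma mult_zero [simp]: "t \<cdot> \<zero> = \<zero>"
  by (induction t) auto

lemma mult_add: "x \<in> A \<Longrightarrow> (s + t) \<cdot> x = s \<cdot> x \<oplus> t \<cdot> x"
  by (induction t) (auto simp: assoc)

lemma mult_mult: "x \<in> A \<Longrightarrow> s \<cdot> t \<cdot> x = (s * t) \<cdot> x"
  by (induction s) (auto simp: mult_add commute)

lemma mult_plus: "x \<in> A \<Longrightarrow> y \<in> A \<Longrightarrow> t \<cdot> (x \<oplus> y) = t \<cdot> x \<oplus> t \<cdot> y"
  by (induction t) (auto simp: ac)

lemma mult_mono: "s \<le> t \<Longrightarrow> x \<preceq> y \<Longrightarrow> x \<in> A \<Longrightarrow> y \<in> A \<Longrightarrow> s \<cdot> x \<preceq> t \<cdot> y"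
proof -
  assume *: "s \<le> t" "x \<preceq> y" "x \<in> A" "y \<in> A"
  have "s \<cdot> x \<preceq> s \<cdot> y" using * by (induction s) (auto intro!: plus_mono)
  moreover have "s \<cdot> y \<preceq> t \<cdot> y" using * mult_add[of y s "t - s"] by simp
  ultimately show ?thesis using * le_trans by (meson mult_closed)
qed


section \<open>Common measures\<close>

text \<open>
  In an ordered group whose interval from \<open>0\<close> to \<open>1\<close> is the algebra, this says \<open>k z \<le> 1\<close>: the first \<open>k\<close>
  multiples of \<open>z\<close> are the same there and in the algebra.
\<close>
definition no_overflow :: "nat \<Rightarrow> 'a \<Rightarrow> bool" where
  "no_overflow k z \<longleftrightarrow> (\<forall>j<k. j \<cdot> z \<bottom> z)"

lemma no_overflowI:
  assumes "(k - 1) \<cdot> z \<bottom> z" "z \<in> A" shows "no_overflow k z"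
  unfolding no_overflow_def
proof (intro allI impI)
  fix j assume "j < k"
  then have "j \<cdot> z \<preceq> (k - 1) \<cdot> z" using assms(2) by (intro mult_mono) auto
  then show "j \<cdot> z \<bottom> z" using orth_mono[OF assms(1)] assms(2) by simp
qed

lemma no_overflow_orth:
  assumes "no_overflow k z" "i + j \<le> k" "z \<in> A" shows "i \<cdot> z \<bottom> j \<cdot> z"
  using assms(2)
proof (induction j arbitrary: i)
  case (Suc j)
  have "i \<cdot> z \<bottom> z" using Suc.prems assms(1) by (auto simp: no_overflow_def)
  moreover have "i \<cdot> z \<oplus> z \<bottom> j \<cdot> z" using Suc.IH[of "Suc i"] Suc.prems by simp
  ultimately have "i \<cdot> z \<bottom> z \<oplus> j \<cdot> z" by (rule orth_assoc(2)) (simp_all add: assms(3))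
  then show ?case using assms(3) by (simp add: commute)
qed (simp add: assms)

lemma no_overflow_mult:
  assumes "no_overflow b v" "no_overflow l (b \<cdot> v)" "v \<in> A" shows "no_overflow (l * b) v"
proof (cases "l = 0 \<or> b = 0")
  case False
  then obtain b' l' where b: "b = Suc b'" "l = Suc l'" by (metis not0_implies_Suc)
  have "b \<cdot> v \<bottom> l' \<cdot> b \<cdot> v"
    by (rule orth_sym) (use assms b in \<open>auto simp: no_overflow_def\<close>)
  then have "v \<oplus> b' \<cdot> v \<bottom> l' \<cdot> b \<cdot> v" using assms b by (simp add: commute)
  moreover have "v \<bottom> b' \<cdot> v"
    by (rule orth_sym) (use assms b in \<open>auto simp: no_overflow_def\<close>)
  ultimately have "v \<bottom> b' \<cdot> v \<oplus> l' \<cdot> b \<cdot> v" using assms(3) orth_assoc(2)[of v "b' \<cdot> v" "l' \<cdot> b \<cdot> v"] by simp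
  moreover have "b' \<cdot> v \<oplus> l' \<cdot> b \<cdot> v = (l * b - 1) \<cdot> v"
    unfolding mult_mult[OF assms(3)] mult_add[OF assms(3), symmetric] using b by (simp add: algebra_simps)
  ultimately have "v \<bottom> (l * b - 1) \<cdot> v" by simp
  then show ?thesis using assms(3) orth_sym[of v] by (intro no_overflowI) auto
qed (auto simp: no_overflow_def)

text \<open>
  Copies of \<open>e\<close> can be removed one at a time: by residuation \<open>d \<ominus> j \<cdot> e\<close> lies below \<open>e\<close> as soon as
  \<open>d \<preceq> Suc j \<cdot> e\<close>, and it lies below \<open>d\<close> anyway.
\<close>
lemma disjoint_from_multiple:
  assumes "\<And>u. u \<in> A \<Longrightarrow> u \<preceq> d \<Longrightarrow> u \<preceq> e \<Longrightarrow> u = \<zero>" "d \<preceq> j \<cdot> e" "d \<in> A" "e \<in> A"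
  shows "d = \<zero>"
  using assms(2)
proof (induction j)
  case (Suc j)
  have "d \<ominus> j \<cdot> e \<preceq> e" using Suc.prems assms(3,4) by (subst minus_le_iff) auto
  then have "d \<ominus> j \<cdot> e = \<zero>" using assms minus_le by simp
  then have "d \<preceq> j \<cdot> e" using assms by (metis neg_neg neg_closed plus_closed mult_closed)
  then show ?case by (rule Suc.IH)
qed (simp add: assms le_zero)

text \<open>
  Splitting one element into more equal parts gives smaller parts.  With \<open>i\<close> the meet of \<open>z\<close> and \<open>w\<close>,
  and \<open>e = z \<ominus> w\<close>, the inequality \<open>k \<le> l\<close> gives \<open>l \<cdot> w = k \<cdot> i \<oplus> k \<cdot> e \<preceq> (l - 1) \<cdot> w \<oplus> i \<oplus> k \<cdot> e\<close>.
  Cancelling \<open>l - 1\<close> copies of \<open>w\<close> bounds the excess \<open>d = w \<ominus> z\<close> by \<open>k \<cdot> e\<close>; but \<open>d\<close> is disjoint from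
  \<open>e\<close>, so \<open>d = \<zero>\<close>.
\<close>
lemma more_parts_smaller:
  assumes "k \<cdot> z = l \<cdot> w" "0 < k" "k \<le> l" "no_overflow l w" and A: "z \<in> A" "w \<in> A"
  shows "w \<preceq> z"
proof -
  define e where "e = z \<ominus> w"
  define i where "i = z \<ominus> e"
  define d where "d = w \<ominus> z"
  have c: "e \<in> A" "i \<in> A" "d \<in> A" using A by (auto simp: e_def i_def d_def)
  have z: "z = i \<oplus> e" using A minus_plus[of e z] minus_le[of z w] by (simp add: i_def e_def)
  have "i \<preceq> w" using A sup_ge[of z w] c unfolding i_def
    by (subst minus_le_iff) (auto simp: e_def)
  then have "k \<cdot> i \<preceq> (l - 1) \<cdot> w \<oplus> i"
    using plus_mono[of "(k - 1) \<cdot> i" "(l - 1) \<cdot> w" i i] assms c mult_mono[of "k - 1" "l - 1" i w]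
    by (cases k) auto
  then have "k \<cdot> i \<oplus> k \<cdot> e \<preceq> ((l - 1) \<cdot> w \<oplus> i) \<oplus> k \<cdot> e" using A c by (intro plus_mono) auto
  moreover have "k \<cdot> i \<oplus> k \<cdot> e = w \<oplus> (l - 1) \<cdot> w"
    using assms z c mult_plus[of i e k] by (cases l) (auto simp: commute)
  ultimately have "(w \<oplus> (l - 1) \<cdot> w) \<ominus> (l - 1) \<cdot> w \<preceq> i \<oplus> k \<cdot> e"
    using A c by (subst minus_le_iff) (auto simp: assoc)
  moreover have "w \<bottom> (l - 1) \<cdot> w"
    by (rule orth_sym) (use assms in \<open>auto simp: no_overflow_def\<close>)
  ultimately have "w \<preceq> i \<oplus> k \<cdot> e" by (simp only: plus_minus mult_closed A)
  then have "w \<ominus> i \<preceq> k \<cdot> e" using A c by (subst minus_le_iff) auto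
  moreover have "d \<preceq> w \<ominus> i" unfolding d_def using A c z by (intro minus_mono) auto
  ultimately have "d \<preceq> k \<cdot> e" using le_trans A c by (meson mult_closed neg_closed plus_closed)
  moreover have "u = \<zero>" if "u \<in> A" "u \<preceq> d" "u \<preceq> e" for u
    using differences_disjoint[of u w z] that A by (auto simp: d_def e_def)
  ultimately have "d = \<zero>" using disjoint_from_multiple[of d e k] c by blast
  then show ?thesis using A unfolding d_def by (metis neg_neg neg_closed plus_closed)
qed

text \<open>
  A sum of \<open>k\<close> copies of \<open>x \<oplus> y\<close> without truncation can be rearranged.  The proof follows one step of the
  rearrangement, \<open>(a \<oplus> b) \<oplus> (x \<oplus> y) = (x \<oplus> a) \<oplus> (b \<oplus> y)\<close>, and moves orthogonality along at each change of
  brackets.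
\<close>
lemma orth_mult_plus:
  assumes "no_overflow k (x \<oplus> y)" "x \<bottom> y" "x \<in> A" "y \<in> A" shows "k \<cdot> x \<bottom> k \<cdot> y"
  using assms(1)
proof (induction k)
  case (Suc k)
  let ?a = "k \<cdot> x" and ?b = "k \<cdot> y"
  have ab: "?a \<bottom> ?b" using Suc by (simp add: no_overflow_def)
  have "?a \<oplus> ?b \<bottom> x \<oplus> y" using Suc.prems assms by (simp add: no_overflow_def mult_plus)
  then have *: "?b \<bottom> x \<oplus> y" "?a \<bottom> ?b \<oplus> (x \<oplus> y)" using orth_assoc[of ?a ?b "x \<oplus> y"] ab assms by auto
  have "y \<bottom> x" "y \<oplus> x \<bottom> ?b" using orth_sym * assms by (auto simp: commute)
  then have **: "x \<bottom> ?b" "y \<bottom> x \<oplus> ?b" using orth_assoc[of y x ?b] assms by auto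
  have 1: "(x \<oplus> ?b) \<bottom> y" using ** assms orth_sym[of y "x \<oplus> ?b"] by simp
  have 2: "x \<bottom> ?b \<oplus> y" using orth_assoc[OF **(1) 1] assms by simp
  have "(?b \<oplus> y) \<oplus> x \<bottom> ?a" using orth_sym[of ?a "?b \<oplus> (x \<oplus> y)"] * assms by (simp add: ac)
  then have "x \<bottom> ?a" "?b \<oplus> y \<bottom> x \<oplus> ?a"
    using orth_assoc[of "?b \<oplus> y" x ?a] orth_sym[OF 2] assms by auto
  then have "x \<oplus> ?a \<bottom> ?b \<oplus> y" using orth_sym[of "?b \<oplus> y"] assms by simp
  then show ?case using assms by (simp add: commute)
qed simp

text \<open>
  The subtractive Euclidean algorithm.  If \<open>k < l\<close> then \<open>w \<preceq> z\<close>, and with \<open>e = z \<ominus> w\<close> the relation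
  \<open>k \<cdot> z = l \<cdot> w\<close> becomes \<open>k \<cdot> e = (l - k) \<cdot> w\<close> after cancelling \<open>k \<cdot> w\<close>.  Since the common value of the
  two sides shrinks, the relation cannot be required to have the value \<open>\<one>\<close>.
\<close>
lemma common_measure:
  assumes "k \<cdot> z = l \<cdot> w" "0 < k" "0 < l" "no_overflow k z" "no_overflow l w" "z \<in> A" "w \<in> A"
  shows "\<exists>v\<in>A. \<exists>a b. z = a \<cdot> v \<and> w = b \<cdot> v \<and> k * a = l * b
    \<and> no_overflow a v \<and> no_overflow b v"
  using assms
proof (induction "k + l" arbitrary: k l z w rule: less_induct)
  case less
  \<comment> \<open>Stated for arbitrary \<open>k < l\<close>, because the case \<open>l < k\<close> is the same with the roles exchanged.\<close>
  have step: "\<exists>v\<in>A. \<exists>a b. z = a \<cdot> v \<and> w = b \<cdot> v \<and> k * a = l * b \<and> no_overflow a v \<and> no_overflow b v"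
    if eq: "k \<cdot> z = l \<cdot> w" and pos: "0 < k" and lt: "k < l"
      and no: "no_overflow k z" "no_overflow l w" and A: "z \<in> A" "w \<in> A"
      and IH: "\<And>k' l' z w. k' + l' < k + l \<Longrightarrow> k' \<cdot> z = l' \<cdot> w \<Longrightarrow> 0 < k' \<Longrightarrow> 0 < l' \<Longrightarrow>
        no_overflow k' z \<Longrightarrow> no_overflow l' w \<Longrightarrow> z \<in> A \<Longrightarrow> w \<in> A \<Longrightarrow>
        \<exists>v\<in>A. \<exists>a b. z = a \<cdot> v \<and> w = b \<cdot> v \<and> k' * a = l' * b \<and> no_overflow a v \<and> no_overflow b v"
    for k l z w
  proof -
    define e where "e = z \<ominus> w"
    have e: "e \<in> A" using A by (simp add: e_def)
    have wz: "w \<preceq> z" using more_parts_smaller eq pos lt no A by simp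
    have z: "z = e \<oplus> w" using minus_plus[OF wz] A by (simp add: e_def)
    have ew: "e \<bottom> w" unfolding e_def using A by (intro neg_antimono) auto
    have "k \<cdot> e = (l - k) \<cdot> w"
    proof (rule orth_cancel[where y = "k \<cdot> w"])
      show "k \<cdot> e \<oplus> k \<cdot> w = (l - k) \<cdot> w \<oplus> k \<cdot> w"
        using eq lt A e by (simp add: z flip: mult_plus mult_add)
      show "k \<cdot> e \<bottom> k \<cdot> w" using orth_mult_plus ew no A e z by simp
      show "(l - k) \<cdot> w \<bottom> k \<cdot> w" using no_overflow_orth no lt A by simp
    qed (use A e in auto)
    moreover have "no_overflow k e"
      unfolding no_overflow_def
    proof (intro allI impI)
      fix j assume "j < k"
      then have "j \<cdot> z \<bottom> z" using no by (simp add: no_overflow_def)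
      then show "j \<cdot> e \<bottom> e" using A e minus_le
        by (elim orth_mono) (auto intro!: mult_mono simp: e_def)
    qed
    moreover have "no_overflow (l - k) w" using no by (simp add: no_overflow_def)
    ultimately obtain v a b where v: "v \<in> A" "e = a \<cdot> v" "w = b \<cdot> v" "k * a = (l - k) * b"
      "no_overflow a v" "no_overflow b v"
      using IH[of k "l - k" e w] pos lt A e by auto
    have "k * (a + b) = l * b" using v(4) lt by (simp add: algebra_simps)
    moreover have "no_overflow (a + b) v"
    proof (cases b)
      case (Suc b')
      have "v \<oplus> b' \<cdot> v \<bottom> a \<cdot> v" using ew v Suc orth_sym[of "a \<cdot> v" "b \<cdot> v"] by (simp add: commute)
      moreover have "v \<bottom> b' \<cdot> v"
        by (rule orth_sym) (use v Suc in \<open>auto simp: no_overflow_def\<close>)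
      ultimately have "v \<bottom> b' \<cdot> v \<oplus> a \<cdot> v" using v orth_assoc(2)[of v "b' \<cdot> v" "a \<cdot> v"] by simp
      then have "v \<bottom> (a + b - 1) \<cdot> v" using Suc v by (simp add: mult_add commute)
      then have "(a + b - 1) \<cdot> v \<bottom> v" using v orth_sym by simp
      then show ?thesis using v by (intro no_overflowI)
    qed (use v in auto)
    ultimately show ?thesis using v z by (metis mult_add)
  qed
  consider "k < l" | "l < k" | "k = l" by linarith
  then show ?case
  proof cases
    case 1
    then show ?thesis using step[of k z l w] less by simp
  next
    case 2
    have "\<exists>v\<in>A. \<exists>a b. w = a \<cdot> v \<and> z = b \<cdot> v \<and> l * a = k * b \<and> no_overflow a v \<and> no_overflow b v"
      by (rule step) (use 2 less in \<open>auto simp: add.commute\<close>)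
    then show ?thesis by metis
  next
    case 3
    then have "w \<preceq> z" "z \<preceq> w"
      using less.prems more_parts_smaller[of k z l w] more_parts_smaller[of l w k z] by simp_all
    then have "z = w" using less.prems le_antisym by simp
    moreover have "no_overflow 1 w" using less.prems by (simp add: no_overflow_def)
    ultimately have "z = 1 \<cdot> w \<and> w = 1 \<cdot> w \<and> k * 1 = l * 1 \<and> no_overflow 1 w \<and> no_overflow 1 w"
      using less.prems 3 by simp
    then show ?thesis using less.prems by blast
  qed
qed

text \<open>
  The generators are the exact \<open>k\<close>-th parts of \<open>\<one>\<close>.
\<close>
lemma generator_iff:
  assumes "0 < k" "z \<in> A"
  shows "generator M k z \<longleftrightarrow> no_overflow k z \<and> k \<cdot> z = \<one>"
proof -
  obtain k' where k: "k = Suc k'" using assms by (metis gr0_conv_Suc)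
  have "no_overflow k z \<longleftrightarrow> k' \<cdot> z \<bottom> z"
    using assms k no_overflowI[of k z] by (auto simp: no_overflow_def)
  moreover have "k' \<cdot> z = \<sim> z \<longleftrightarrow> k' \<cdot> z \<preceq> \<sim> z \<and> \<sim> z \<preceq> k' \<cdot> z"
    using assms le_antisym[of "k' \<cdot> z" "\<sim> z"] by auto
  ultimately show ?thesis using assms k by (auto simp: generator_def commute)
qed

text \<open>
  Both \<open>z\<close> and \<open>w\<close> are exact parts of \<open>\<one>\<close>, so they have a common measure \<open>v\<close>, which is again an exact part
  of \<open>\<one>\<close>.
\<close>
lemma generator_common:
  assumes "generator M k z" "generator M l w" "0 < k" "0 < l"
  shows "\<exists>v a b. generator M (k * a) v \<and> z = a \<cdot> v \<and> w = b \<cdot> v \<and> k * a = l * b"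
proof -
  have A: "z \<in> A" "w \<in> A" using assms by (auto simp: generator_def)
  have *: "no_overflow k z" "k \<cdot> z = \<one>" "no_overflow l w" "l \<cdot> w = \<one>"
    using assms A generator_iff by auto
  then obtain v a b where v: "v \<in> A" "z = a \<cdot> v" "w = b \<cdot> v" "k * a = l * b"
    "no_overflow a v" "no_overflow b v"
    using common_measure[of k z l w] assms A by auto
  have one: "(k * a) \<cdot> v = \<one>" using * v by (simp add: mult_mult)
  have "no_overflow (k * a) v" using v * by (intro no_overflow_mult) auto
  then have "generator M (k * a) v" if "0 < k * a" using generator_iff[OF that v(1)] one by blast
  moreover have "generator M (k * a) v" if "\<not> 0 < k * a"
    using one that v(1) unfolding generator_def by auto
  ultimately show ?thesis using v by blast
qed

lemma trivial_eq_zero: "\<zero> = \<one> \<Longrightarrow> x \<in> A \<Longrightarrow> x = \<zero>"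
  using plus_zero[of x] plus_one[of x] by simp

text \<open>
  A homomorphism from a chain is injective unless its codomain is trivial, because chains are
  simple.
\<close>
lemma generator_nat_eq_imp_trivial:
  assumes "generator M k z" "a < b" "b \<le> k" "a \<cdot> z = b \<cdot> z" shows "\<zero> = \<one>"
proof -
  have z: "z \<in> A" using assms by (simp add: generator_def)
  have k: "no_overflow k z" "k \<cdot> z = \<one>" using generator_iff[of k z] assms z by auto
  have "(b - a) \<cdot> z = \<zero>"
  proof (rule orth_cancel[where y = "a \<cdot> z"])
    show "(b - a) \<cdot> z \<oplus> a \<cdot> z = \<zero> \<oplus> a \<cdot> z" using mult_add[of z "b - a" a] assms z by simp
    show "(b - a) \<cdot> z \<bottom> a \<cdot> z" using no_overflow_orth[OF k(1) _ z, of "b - a" a] assms(2,3) by simp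
  qed (use z in auto)
  moreover have "1 \<cdot> z \<preceq> (b - a) \<cdot> z" using assms z by (intro mult_mono) auto
  ultimately have "z = \<zero>" using le_zero[of z] z by simp
  then show ?thesis using k(2) by simp
qed

end


section \<open>Homomorphisms from finite chains\<close>

lemma mv_algebra_chain: "mv_algebra (chain n)"
  by unfold_locales (auto simp: chain_def)

lemma generator_mult_hom:
  assumes M: "mv_algebra M" and gen: "generator M k z"
  shows "mv_hom (chain k) M (\<lambda>j. mult M j z)"
proof -
  interpret mv_algebra M by fact
  have z: "z \<in> A" using gen by (simp add: generator_def)
  show ?thesis
  proof (cases "k = 0")
    case True
    then have "\<zero> = \<one>" using gen by (simp add: generator_def)
    then have "x = y" if "x \<in> A" "y \<in> A" for x y using trivial_eq_zero that by metis
    then show ?thesis using M z mv_algebra_chain by (auto simp: mv_hom_def)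
  next
    case False
    then have k: "no_overflow k z" "k \<cdot> z = \<one>" using generator_iff gen z by auto
    have "(k - j) \<cdot> z = \<sim> (j \<cdot> z)" if "j \<le> k" for j
    proof (rule le_antisym)
      show "(k - j) \<cdot> z \<preceq> \<sim> (j \<cdot> z)" using no_overflow_orth[OF k(1) _ z, of "k - j" j] that by simp
      show "\<sim> (j \<cdot> z) \<preceq> (k - j) \<cdot> z" using mult_add[of z j "k - j"] k that z by simp
    qed (use z in auto)
    moreover have "min (i + j) k \<cdot> z = i \<cdot> z \<oplus> j \<cdot> z" for i j
      using mult_add[of z k "i + j - k"] k z by (auto simp: min_def simp flip: mult_add)
    ultimately show ?thesis using M z mv_algebra_chain by (auto simp: mv_hom_def chain_def)
  qed
qed

text \<open>
  For \<open>a = 0\<close> this is the homomorphism onto the one-element algebra.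
\<close>
lemma chain_stretch_hom: "mv_hom (chain k) (chain (k * a)) (\<lambda>j. j * a)"
  using mv_algebra_chain
  by (auto simp: mv_hom_def chain_def nat_mult_min_left add_mult_distrib diff_mult_distrib)

lemma eval_trm_closed:
  assumes "mv_algebra M" "\<And>i. i < n \<Longrightarrow> e i \<in> universe M" "wf_trm n s"
  shows "eval_trm M e s \<in> universe M"
proof -
  interpret mv_algebra M by fact
  show ?thesis by (rule eval_closed) (use assms in auto)
qed

lemma eval_trm_hom:
  assumes f: "mv_hom M N f" and "\<And>i. i < n \<Longrightarrow> e i \<in> universe M" "\<And>i. i < n \<Longrightarrow> f (e i) = e' i" "wf_trm n s"
  shows "f (eval_trm M e s) = eval_trm N e' s"
  using assms(4)
  by (induction s) (use assms eval_trm_closed[of M n e] in \<open>auto simp: mv_hom_def\<close>)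

text \<open>
  Geometric formulae have neither implication nor universal quantification, hence are preserved by
  all homomorphisms.
\<close>
lemma sat_hom:
  assumes f: "mv_hom M N f" and "wf_form \<phi> n" "\<And>i. i < n \<Longrightarrow> e i \<in> universe M"
    "\<And>i. i < n \<Longrightarrow> f (e i) = e' i" "sat M \<phi> e"
  shows "sat N \<phi> e'"
  using assms(2-)
proof (induction \<phi> arbitrary: n e e')
  case (Eq s t)
  then show ?case using eval_trm_hom[OF f, of n e e'] by simp metis
next
  case (And \<phi> \<psi>)
  show ?case using And.prems And.IH[of n e e'] by simp
next
  case (Disj I F)
  then obtain i where i: "i \<in> I" "sat M (F i) e" by auto
  have "sat N (F i) e'"
    by (rule Disj.IH[OF rangeI, of i n e]) (use Disj.prems i in auto)
  then show ?case using i by auto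
next
  case (Ex \<phi>)
  then obtain a where a: "a \<in> universe M" "sat M \<phi> (case_nat a e)" by auto
  have "sat N \<phi> (case_nat (f a) e')"
    by (rule Ex.IH[OF _ _ _ a(2), of "Suc n"])
      (use Ex.prems a(1) in \<open>auto split: nat.splits\<close>)
  moreover have "f a \<in> universe N" using a f by (auto simp: mv_hom_def)
  ultimately show ?case by auto
qed auto

lemma mv_algebra_satisfies_MV: "mv_algebra M \<Longrightarrow> s \<in> MV \<Longrightarrow> satisfies M s"
  unfolding mv_algebra_def MV_def Let_def by auto

lemma eval_multiple:
  assumes "mv_algebra M" "eval_trm M e s \<in> universe M"
  shows "eval_trm M e (multiple t s) = mult M t (eval_trm M e s)"
proof -
  interpret mv_algebra M by fact
  show ?thesis using assms(2) by (induction t s rule: multiple.induct) auto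
qed


lemma mult_hom:
  assumes "mv_hom M N f" "x \<in> universe M" shows "f (mult M t x) = mult N t (f x)"
proof -
  interpret M: mv_algebra M using assms by (simp add: mv_hom_def)
  show ?thesis using assms by (induction t) (auto simp: mv_hom_def)
qed

lemma generator_hom:
  assumes "mv_hom M N f" "generator M k z" shows "generator N k (f z)"
proof -
  interpret M: mv_algebra M using assms by (simp add: mv_hom_def)
  have z: "z \<in> universe M" using assms by (simp add: generator_def)
  have *: "f z \<in> universe N" "f (mv_zero M) = mv_zero N"
    "f (mv_neg M (mv_zero M)) = mv_neg N (mv_zero N)" "f (mv_neg M z) = mv_neg N (f z)"
    using assms(1) z by (auto simp: mv_hom_def)
  show ?thesis
  proof (cases "k = 0")
    case True
    then show ?thesis using assms(2) * unfolding generator_def by metis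
  next
    case False
    then have "mult M (k - 1) z = mv_neg M z" using assms(2) by (simp add: generator_def)
    then show ?thesis using False * mult_hom[OF assms(1) z, of "k - 1"] by (simp add: generator_def)
  qed
qed


section \<open>Tuples that come from a finite chain\<close>

text \<open>
  The entries of \<open>e\<close> below \<open>n\<close> are the images, under one homomorphism from a finite chain \<open>chain k\<close>, of
  a tuple \<open>t\<close> with the property \<open>P k\<close>.
\<close>
definition spanned ::
  "'a mv_structure \<Rightarrow> nat \<Rightarrow> (nat \<Rightarrow> 'a) \<Rightarrow> (nat \<Rightarrow> (nat \<Rightarrow> nat) \<Rightarrow> bool) \<Rightarrow> bool" where
  "spanned M n e P \<longleftrightarrow> (\<exists>k z t. generator M k z \<and>
    (\<forall>i<n. t i \<le> k \<and> e i = mult M (t i) z) \<and> P k t)"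

lemma spannedI:
  assumes "generator M k z" "\<And>i. i < n \<Longrightarrow> t i \<le> k" "\<And>i. i < n \<Longrightarrow> e i = mult M (t i) z" "P k t"
  shows "spanned M n e P"
  using assms unfolding spanned_def by blast

lemma spannedE:
  assumes "spanned M n e P"
  obtains k z t where "generator M k z" "\<And>i. i < n \<Longrightarrow> t i \<le> k"
    "\<And>i. i < n \<Longrightarrow> e i = mult M (t i) z" "P k t"
  using assms unfolding spanned_def by blast

lemma spanned_mono:
  assumes "spanned M n e P" "\<And>k t. P k t \<Longrightarrow> Q k t"
  shows "spanned M n e Q"
  using assms unfolding spanned_def by blast

lemma spanned_hom:
  assumes "mv_hom M N f" "spanned M n e P" "\<And>i. i < n \<Longrightarrow> f (e i) = e' i"
  shows "spanned N n e' P"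
proof -
  obtain k z t where *: "generator M k z" "\<And>i. i < n \<Longrightarrow> t i \<le> k"
    "\<And>i. i < n \<Longrightarrow> e i = mult M (t i) z" "P k t"
    using assms(2) by (rule spannedE) blast
  have z: "z \<in> universe M" using *(1) by (simp add: generator_def)
  have "e' i = mult N (t i) (f z)" if "i < n" for i
    using *(3) assms(3) mult_hom[OF assms(1) z] that by metis
  then show ?thesis using * generator_hom[OF assms(1)] by (intro spannedI[of N k "f z" n t])
qed

lemma spanned_trivial:
  assumes "mv_algebra M" "mv_zero M = mv_neg M (mv_zero M)" "\<And>i. i < n \<Longrightarrow> e i \<in> universe M"
    "P k (\<lambda>_. 0)"
  shows "spanned M n e P"
proof -
  interpret mv_algebra M by fact
  have "generator M k \<zero>" "\<And>i. i < n \<Longrightarrow> e i = 0 \<cdot> \<zero>"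
    using assms(2,3) trivial_eq_zero by (auto simp: generator_def)
  then show ?thesis using assms(4) by (intro spannedI[of M k \<zero> n "\<lambda>_. 0"]) auto
qed

lemma sat_chain_trivial:
  assumes "sat (chain k) \<phi> t" "wf_form \<phi> n" "\<And>i. i < n \<Longrightarrow> t i \<le> k"
  shows "sat (chain 0) \<phi> (\<lambda>_. 0)"
  using sat_hom[OF chain_stretch_hom[of k 0], of \<phi> n t] assms by (simp add: chain_def)

lemma generator_multiples_cases:
  assumes "mv_algebra M" "generator M k z" "a \<le> k" "b \<le> k" "mult M a z = mult M b z"
  shows "a = b \<or> mv_zero M = mv_neg M (mv_zero M)"
  using mv_algebra.generator_nat_eq_imp_trivial[OF assms(1,2)] assms(3-5)
  by (metis linorder_neqE_nat)

text \<open>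
  The two tuples that represent \<open>e\<close> live in different chains.  After stretching both into the common
  chain they have the same image; so they are equal, or the algebra is trivial and \<open>chain 0\<close> serves as
  representing chain.
\<close>
lemma spanned_And:
  assumes M: "mv_algebra M" and wf: "wf_form \<phi> n" "wf_form \<psi> n"
    and "spanned M n e (\<lambda>k. sat (chain k) \<phi>)" "spanned M n e (\<lambda>k. sat (chain k) \<psi>)"
  shows "spanned M n e (\<lambda>k. sat (chain k) (And \<phi> \<psi>))"
proof -
  interpret mv_algebra M by fact
  obtain k z t where z: "generator M k z"
    and t: "\<And>i. i < n \<Longrightarrow> t i \<le> k" "\<And>i. i < n \<Longrightarrow> e i = t i \<cdot> z" "sat (chain k) \<phi> t"
    using assms by (elim spannedE) blast
  obtain l w u where w: "generator M l w"
    and u: "\<And>i. i < n \<Longrightarrow> u i \<le> l" "\<And>i. i < n \<Longrightarrow> e i = u i \<cdot> w" "sat (chain l) \<psi> u"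
    using assms by (elim spannedE) blast
  have zA: "z \<in> A" using z by (simp add: generator_def)
  have "sat (chain 0) \<phi> (\<lambda>_. 0)" "sat (chain 0) \<psi> (\<lambda>_. 0)"
    using sat_chain_trivial[OF t(3) wf(1) t(1)] sat_chain_trivial[OF u(3) wf(2) u(1)] by auto
  then have triv: ?thesis if "\<zero> = \<one>"
    using spanned_trivial[OF M that, of n e _ 0] t(2) zA by simp
  consider "\<zero> = \<one>" | "0 < k" "0 < l"
    using z w by (cases "k = 0"; cases "l = 0") (simp_all add: generator_def)
  then show ?thesis
  proof cases
    case 2
    then obtain v a b where v: "generator M (k * a) v" "z = a \<cdot> v" "w = b \<cdot> v" "k * a = l * b"
      using generator_common z w by metis
    have vA: "v \<in> A" using v by (simp add: generator_def)
    have e: "e i = (t i * a) \<cdot> v" "e i = (u i * b) \<cdot> v" if "i < n" for i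
      using t(2) u(2) that v(2,3) vA by (metis mult_mult)+
    have le: "t i * a \<le> k * a" "u i * b \<le> k * a" if "i < n" for i
      using mult_le_mono1[OF t(1)[OF that], of a] mult_le_mono1[OF u(1)[OF that], of b] v(4) by auto
    show ?thesis
    proof (cases "\<forall>i<n. t i * a = u i * b")
      case True
      have "sat (chain (k * a)) \<phi> (\<lambda>i. t i * a)"
        by (rule sat_hom[OF chain_stretch_hom wf(1) _ _ t(3)]) (use t(1) in \<open>auto simp: chain_def\<close>)
      moreover have "sat (chain (l * b)) \<psi> (\<lambda>i. t i * a)"
        by (rule sat_hom[OF chain_stretch_hom wf(2) _ _ u(3)]) (use True u(1) in \<open>auto simp: chain_def\<close>)
      ultimately have "sat (chain (k * a)) (And \<phi> \<psi>) (\<lambda>i. t i * a)" using v(4) by simp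
      then show ?thesis using v(1) e(1) le(1) by (intro spannedI[of M "k * a" v n "\<lambda>i. t i * a"])
    next
      case False
      then show ?thesis using generator_multiples_cases[OF M v(1)] e le triv by metis
    qed
  qed (rule triv)
qed

text \<open>
  The values of \<open>r\<close> and \<open>s\<close> in the representing chain have the same image in \<open>M\<close>.  So they agree, or \<open>M\<close> is
  trivial and \<open>chain 0\<close>, in which all equations hold, can represent \<open>e\<close> instead.
\<close>
lemma spanned_Eq:
  assumes M: "mv_algebra M" and wf: "wf_trm n r" "wf_trm n s"
    and "spanned M n e (\<lambda>_ _. True)" and eq: "eval_trm M e r = eval_trm M e s"
  shows "spanned M n e (\<lambda>k. sat (chain k) (Eq r s))"
proof -
  interpret mv_algebra M by fact
  obtain k z t where t: "generator M k z" "\<And>i. i < n \<Longrightarrow> t i \<le> k"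
    "\<And>i. i < n \<Longrightarrow> e i = t i \<cdot> z"
    using assms by (elim spannedE) blast
  have z: "z \<in> A" using t by (simp add: generator_def)
  have tc: "t i \<in> universe (chain k)" if "i < n" for i using t(2) that by (simp add: chain_def)
  have ev: "eval_trm (chain k) t q \<cdot> z = eval_trm M e q" "eval_trm (chain k) t q \<le> k"
    if "wf_trm n q" for q
    using eval_trm_hom[OF generator_mult_hom[OF M t(1)], of n t e q]
      eval_trm_closed[OF mv_algebra_chain, of n t k q] t(3) tc that by (auto simp: chain_def)
  then consider "eval_trm (chain k) t r = eval_trm (chain k) t s" | "\<zero> = \<one>"
    using generator_multiples_cases[OF M t(1)] eq wf by metis
  then show ?thesis
  proof cases
    case 1
    then show ?thesis using t by (intro spannedI[of M k z n t]) auto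
  next
    case 2
    have "eval_trm (chain 0) (\<lambda>_. 0) q = 0" for q by (induction q) (auto simp: chain_def)
    then show ?thesis using spanned_trivial[OF M 2, of n e "\<lambda>k. sat (chain k) (Eq r s)" 0] t(3) z by simp
  qed
qed

lemma spanned_0: assumes "mv_algebra M" shows "spanned M 0 e (\<lambda>k t. 0 < k)"
proof -
  interpret mv_algebra M by fact
  have "generator M 1 \<one>" by (simp add: generator_def)
  then show ?thesis by (rule spannedI) auto
qed

text \<open>
  The common generator of \<open>z\<close> and \<open>w\<close> represents the old entries and the new one.  The factor \<open>s\<close> is
  arbitrary, so \<open>s * b\<close> has to be cut down to an element of the chain.
\<close>
lemma spanned_Suc:
  assumes M: "mv_algebra M" and "spanned M n e (\<lambda>k t. 0 < k)"
    and 2: "generator M l w" "0 < l" "e n = mult M s w"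
  shows "spanned M (Suc n) e (\<lambda>k t. 0 < k)"
proof -
  interpret mv_algebra M by fact
  obtain k z t where 1: "generator M k z" "0 < k" "\<And>i. i < n \<Longrightarrow> t i \<le> k"
    "\<And>i. i < n \<Longrightarrow> e i = t i \<cdot> z"
    using assms by (elim spannedE) blast
  have w: "w \<in> A" using 2 by (simp add: generator_def)
  obtain v a b where v: "generator M (k * a) v" "z = a \<cdot> v" "w = b \<cdot> v" "k * a = l * b"
    using generator_common 1(1,2) 2(1,2) by metis
  have vA: "v \<in> A" using v by (simp add: generator_def)
  show ?thesis
  proof (cases "k * a = 0")
    case True
    then have "\<zero> = \<one>" using v(1) by (simp add: generator_def)
    then show ?thesis
      using 1(4) 2(3) vA v(2,3) by (intro spanned_trivial[of M _ _ _ 1]) (auto simp: M less_Suc_eq)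
  next
    case False
    have "min (s * b) (k * a) \<cdot> v = (s * b) \<cdot> v"
      using mult_add[OF vA, of "k * a" "s * b - k * a"] generator_iff[of "k * a" v] v(1) vA False
      by (auto simp: min_def)
    moreover have "t i * a \<le> k * a" if "i < n" for i using 1(3)[OF that] by simp
    ultimately show ?thesis
      using v(1-3) False 1(4) 2(3) vA
      by (intro spannedI[of M "k * a" v "Suc n" "(\<lambda>i. t i * a)(n := min (s * b) (k * a))"])
        (auto simp: less_Suc_eq mult_mult)
  qed
qed


section \<open>Substitution and derived rules of geometric logic\<close>

lemma subst_trm_subst_trm [simp]:
  "subst_trm \<tau> (subst_trm \<sigma> s) = subst_trm (\<lambda>i. subst_trm \<tau> (\<sigma> i)) s"
  by (induction s) auto

lemma subst_trm_Var [simp]: "subst_trm Var s = s"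
  by (induction s) auto

lemma wf_subst_trm: "wf_trm n s \<Longrightarrow> (\<And>i. i < n \<Longrightarrow> wf_trm m (\<sigma> i)) \<Longrightarrow> wf_trm m (subst_trm \<sigma> s)"
  by (induction s) auto

lemma under_binder_simps [simp]:
  "under_binder \<sigma> 0 = Var 0"
  "under_binder \<sigma> (Suc j) = subst_trm (\<lambda>k. Var (Suc k)) (\<sigma> j)"
  by (auto simp: under_binder_def)

lemma under_binder_Var [simp]: "under_binder Var = Var"
  by (rule ext) (simp add: under_binder_def split: nat.split)

lemma subst_under_binder:
  "subst_trm (under_binder \<tau>) (under_binder \<sigma> i) = under_binder (\<lambda>i. subst_trm \<tau> (\<sigma> i)) i"
  by (cases i) auto

lemma subst_subst [simp]: "subst (subst \<phi> \<sigma>) \<tau> = subst \<phi> (\<lambda>i. subst_trm \<tau> (\<sigma> i))"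
  by (induction \<phi> arbitrary: \<sigma> \<tau>) (auto simp: subst_under_binder)

lemma subst_Var [simp]: "subst \<phi> Var = \<phi>"
  by (induction \<phi>) auto

lemma wf_under_binder:
  "(\<And>i. i < n \<Longrightarrow> wf_trm m (\<sigma> i)) \<Longrightarrow> i < Suc n \<Longrightarrow> wf_trm (Suc m) (under_binder \<sigma> i)"
  by (cases i) (auto intro!: wf_subst_trm)

lemma wf_subst: "wf_form \<phi> n \<Longrightarrow> (\<And>i. i < n \<Longrightarrow> wf_trm m (\<sigma> i)) \<Longrightarrow> wf_form (subst \<phi> \<sigma>) m"
proof (induction \<phi> arbitrary: n m \<sigma>)
  case (Ex \<phi>)
  have "wf_form (subst \<phi> (under_binder \<sigma>)) (Suc m)"
    by (rule Ex.IH[of "Suc n"]) (use Ex.prems wf_under_binder[of n m \<sigma>] in auto)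
  then show ?case by simp
qed (auto intro: wf_subst_trm)

lemma wf_weaken: "wf_form \<phi> n \<Longrightarrow> wf_form (weaken \<phi>) (Suc n)"
  by (rule wf_subst) auto

lemma proves_wf: "proves T s \<Longrightarrow> wf_sequent s"
proof (induction rule: proves.induct)
  case (frobenius \<phi> n \<psi>)
  then show ?case using wf_weaken by auto
qed (auto intro: wf_subst wf_weaken)

lemma subst_multiple [simp]: "subst_trm \<sigma> (multiple t s) = multiple t (subst_trm \<sigma> s)"
  by (induction t s rule: multiple.induct) auto

lemma wf_multiple: "wf_trm n s \<Longrightarrow> wf_trm n (multiple t s)"
  by (induction t s rule: multiple.induct) auto

declare proves.cut [trans]

locale mv_theory =
  fixes T :: "'j sequent set"
  assumes MV_subset: "MV \<subseteq> T"
begin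

abbreviation entails ("(_/ \<turnstile>\<^bsub>_\<^esub>/ _)" [50, 0, 50] 50) where
  "\<gamma> \<turnstile>\<^bsub>n\<^esub> \<phi> \<equiv> proves T (Sequent n \<gamma> \<phi>)"

lemma entails_wf: "\<gamma> \<turnstile>\<^bsub>n\<^esub> \<phi> \<Longrightarrow> wf_form \<gamma> n" "\<gamma> \<turnstile>\<^bsub>n\<^esub> \<phi> \<Longrightarrow> wf_form \<phi> n"
  using proves_wf by fastforce+

lemma true_entails_subst:
  assumes "Tru \<turnstile>\<^bsub>m\<^esub> \<phi>" "wf_form \<gamma> n" "\<And>i. i < m \<Longrightarrow> wf_trm n (\<sigma> i)"
  shows "\<gamma> \<turnstile>\<^bsub>n\<^esub> subst \<phi> \<sigma>"
  using cut[OF truth[OF assms(2)]] substitution[OF assms(1,3)] by simp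

lemma entails_refl: "wf_form \<gamma> n \<Longrightarrow> wf_trm n s \<Longrightarrow> \<gamma> \<turnstile>\<^bsub>n\<^esub> Eq s s"
  using true_entails_subst[OF eq_refl, of \<gamma> n "\<lambda>_. s"] by simp

text \<open>
  The hole of \<open>\<phi>\<close> is its variable \<open>0\<close>.  The replacement rule exchanges variables only, so it is applied
  in a context with one variable for each of \<open>s\<close> and \<open>t\<close>, which are substituted afterwards.
\<close>
lemma leibniz:
  assumes \<phi>: "wf_form \<phi> (Suc n)" and "\<gamma> \<turnstile>\<^bsub>n\<^esub> Eq s t" "\<gamma> \<turnstile>\<^bsub>n\<^esub> subst \<phi> (case_nat s Var)"
  shows "\<gamma> \<turnstile>\<^bsub>n\<^esub> subst \<phi> (case_nat t Var)"
proof -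
  define \<psi> where "\<psi> = subst \<phi> (case_nat (Var 0) (\<lambda>i. Var (Suc (Suc i))))"
  define \<sigma> where "\<sigma> = case_nat s (case_nat t Var)"
  have "wf_form \<psi> (Suc (Suc n))" unfolding \<psi>_def
    by (rule wf_subst[OF \<phi>]) (auto split: nat.split)
  then have "And (Eq (Var 0) (Var 1)) \<psi> \<turnstile>\<^bsub>Suc (Suc n)\<^esub> subst \<psi> (Var(0 := Var 1))"
    by (intro eq_replace) auto
  then have "subst (And (Eq (Var 0) (Var 1)) \<psi>) \<sigma> \<turnstile>\<^bsub>n\<^esub> subst (subst \<psi> (Var(0 := Var 1))) \<sigma>"
    by (rule substitution)
      (use entails_wf[OF assms(2)] in \<open>auto simp: \<sigma>_def less_Suc_eq_0_disj split: nat.split\<close>)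
  moreover have "(\<lambda>i. subst_trm \<sigma> (case_nat (Var 0) (\<lambda>i. Var (Suc (Suc i))) i)) = case_nat s Var"
    "(\<lambda>i. subst_trm \<sigma> (subst_trm (Var(0 := Var 1)) (case_nat (Var 0) (\<lambda>i. Var (Suc (Suc i))) i)))
      = case_nat t Var"
    by (auto simp: \<sigma>_def split: nat.split)
  ultimately have "And (Eq s t) (subst \<phi> (case_nat s Var)) \<turnstile>\<^bsub>n\<^esub> subst \<phi> (case_nat t Var)"
    by (simp add: \<psi>_def \<sigma>_def)
  then show ?thesis using and_right[OF assms(2,3)] cut by blast
qed

lemma wf_shift: "wf_trm n s \<Longrightarrow> wf_trm (Suc n) (subst_trm (\<lambda>i. Var (Suc i)) s)"
  by (rule wf_subst_trm) auto

lemma entails_eq_sym: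
  assumes "\<gamma> \<turnstile>\<^bsub>n\<^esub> Eq s t" shows "\<gamma> \<turnstile>\<^bsub>n\<^esub> Eq t s"
  using leibniz[of "Eq (Var 0) (subst_trm (\<lambda>i. Var (Suc i)) s)", OF _ assms]
    entails_wf[OF assms] entails_refl wf_shift by simp

lemma entails_eq_trans:
  assumes "\<gamma> \<turnstile>\<^bsub>n\<^esub> Eq s t" "\<gamma> \<turnstile>\<^bsub>n\<^esub> Eq t u" shows "\<gamma> \<turnstile>\<^bsub>n\<^esub> Eq s u"
  using leibniz[of "Eq (subst_trm (\<lambda>i. Var (Suc i)) s) (Var 0)", OF _ assms(2)] assms(1)
    entails_wf[OF assms(1)] wf_shift by simp

lemma entails_eq_Neg:
  assumes "\<gamma> \<turnstile>\<^bsub>n\<^esub> Eq s t" shows "\<gamma> \<turnstile>\<^bsub>n\<^esub> Eq (Neg s) (Neg t)"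
  using leibniz[of "Eq (Neg (subst_trm (\<lambda>i. Var (Suc i)) s)) (Neg (Var 0))", OF _ assms]
    entails_wf[OF assms] entails_refl wf_shift by simp

lemma entails_eq_Plus:
  assumes "\<gamma> \<turnstile>\<^bsub>n\<^esub> Eq s t" "\<gamma> \<turnstile>\<^bsub>n\<^esub> Eq u v" shows "\<gamma> \<turnstile>\<^bsub>n\<^esub> Eq (Plus s u) (Plus t v)"
proof (rule entails_eq_trans)
  show "\<gamma> \<turnstile>\<^bsub>n\<^esub> Eq (Plus s u) (Plus t u)"
    using leibniz[of "Eq (subst_trm (\<lambda>i. Var (Suc i)) (Plus s u))
      (Plus (Var 0) (subst_trm (\<lambda>i. Var (Suc i)) u))", OF _ assms(1)]
      entails_wf[OF assms(1)] entails_wf[OF assms(2)] entails_refl wf_shift by simp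
  show "\<gamma> \<turnstile>\<^bsub>n\<^esub> Eq (Plus t u) (Plus t v)"
    using leibniz[of "Eq (subst_trm (\<lambda>i. Var (Suc i)) (Plus t u))
      (Plus (subst_trm (\<lambda>i. Var (Suc i)) t) (Var 0))", OF _ assms(2)]
      entails_wf[OF assms(1)] entails_wf[OF assms(2)] entails_refl wf_shift by simp
qed

lemma entails_disjE:
  assumes "\<gamma> \<turnstile>\<^bsub>n\<^esub> Disj I F" "wf_form \<chi> n" "\<And>i. i \<in> I \<Longrightarrow> And \<gamma> (F i) \<turnstile>\<^bsub>n\<^esub> \<chi>"
  shows "\<gamma> \<turnstile>\<^bsub>n\<^esub> \<chi>"
proof -
  note wf = entails_wf[OF assms(1)]
  have "\<gamma> \<turnstile>\<^bsub>n\<^esub> And \<gamma> (Disj I F)" using assms(1) wf by (intro and_right identity)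
  also have "And \<gamma> (Disj I F) \<turnstile>\<^bsub>n\<^esub> Disj I (\<lambda>i. And \<gamma> (F i))" using wf by (rule distributivity)
  also have "Disj I (\<lambda>i. And \<gamma> (F i)) \<turnstile>\<^bsub>n\<^esub> \<chi>"
    by (rule disj_left) (use assms wf in auto)
  finally show ?thesis .
qed

lemma entails_exE:
  assumes "\<gamma> \<turnstile>\<^bsub>n\<^esub> Ex \<phi>" "wf_form \<chi> n" "And (weaken \<gamma>) \<phi> \<turnstile>\<^bsub>Suc n\<^esub> weaken \<chi>"
  shows "\<gamma> \<turnstile>\<^bsub>n\<^esub> \<chi>"
proof -
  note wf = entails_wf[OF assms(1)]
  have "\<gamma> \<turnstile>\<^bsub>n\<^esub> And \<gamma> (Ex \<phi>)" using assms(1) wf by (intro and_right identity)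
  also have "And \<gamma> (Ex \<phi>) \<turnstile>\<^bsub>n\<^esub> Ex (And (weaken \<gamma>) \<phi>)" using wf by (rule frobenius)
  also have "Ex (And (weaken \<gamma>) \<phi>) \<turnstile>\<^bsub>n\<^esub> \<chi>" using assms(2,3) by (rule ex_left)
  finally show ?thesis .
qed

lemma entails_exI:
  assumes "\<gamma> \<turnstile>\<^bsub>n\<^esub> subst \<phi> (case_nat t Var)" "wf_form \<phi> (Suc n)" "wf_trm n t"
  shows "\<gamma> \<turnstile>\<^bsub>n\<^esub> Ex \<phi>"
proof -
  have "\<phi> \<turnstile>\<^bsub>Suc n\<^esub> weaken (Ex \<phi>)" using assms(2) by (intro ex_right identity) simp
  then have "subst \<phi> (case_nat t Var) \<turnstile>\<^bsub>n\<^esub> subst (weaken (Ex \<phi>)) (case_nat t Var)"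
    by (rule substitution) (use assms(3) in \<open>auto split: nat.split\<close>)
  then have "subst \<phi> (case_nat t Var) \<turnstile>\<^bsub>n\<^esub> Ex \<phi>" by (simp del: subst.simps)
  then show ?thesis using assms(1) cut by blast
qed


section \<open>Term models\<close>

text \<open>
  Provable equality implies that both sides are terms over the context \<open>n\<close>, so a class contains terms
  over \<open>n\<close> only.
\<close>
definition cls :: "nat \<Rightarrow> 'j form \<Rightarrow> trm \<Rightarrow> trm set" where
  "cls n \<gamma> s = {t. \<gamma> \<turnstile>\<^bsub>n\<^esub> Eq s t}"

definition term_model :: "nat \<Rightarrow> 'j form \<Rightarrow> trm set mv_structure" where
  "term_model n \<gamma> = \<lparr>universe = cls n \<gamma> ` {s. wf_trm n s},
     mv_plus = (\<lambda>X Y. cls n \<gamma> (Plus (SOME s. s \<in> X) (SOME t. t \<in> Y))),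
     mv_neg = (\<lambda>X. cls n \<gamma> (Neg (SOME s. s \<in> X))),
     mv_zero = cls n \<gamma> Zero\<rparr>"

lemma cls_eqI: "\<gamma> \<turnstile>\<^bsub>n\<^esub> Eq s t \<Longrightarrow> cls n \<gamma> s = cls n \<gamma> t"
  unfolding cls_def using entails_eq_sym entails_eq_trans by blast

lemma cls_eq_iff: "wf_form \<gamma> n \<Longrightarrow> wf_trm n t \<Longrightarrow> cls n \<gamma> s = cls n \<gamma> t \<longleftrightarrow> \<gamma> \<turnstile>\<^bsub>n\<^esub> Eq s t"
  using cls_eqI entails_refl[of \<gamma> n t] unfolding cls_def by blast

lemma some_in_cls: "wf_form \<gamma> n \<Longrightarrow> wf_trm n s \<Longrightarrow> \<gamma> \<turnstile>\<^bsub>n\<^esub> Eq s (SOME t. t \<in> cls n \<gamma> s)"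
  using someI[of "\<lambda>t. t \<in> cls n \<gamma> s" s] entails_refl[of \<gamma> n s] by (simp add: cls_def)

lemma term_model_simps:
  assumes "wf_form \<gamma> n"
  shows "mv_zero (term_model n \<gamma>) = cls n \<gamma> Zero"
    "wf_trm n s \<Longrightarrow> mv_neg (term_model n \<gamma>) (cls n \<gamma> s) = cls n \<gamma> (Neg s)"
    "wf_trm n s \<Longrightarrow> wf_trm n t \<Longrightarrow>
      mv_plus (term_model n \<gamma>) (cls n \<gamma> s) (cls n \<gamma> t) = cls n \<gamma> (Plus s t)"
    "wf_trm n s \<Longrightarrow> cls n \<gamma> s \<in> universe (term_model n \<gamma>)"
  by (auto simp: term_model_def
      intro!: cls_eqI entails_eq_Neg entails_eq_Plus some_in_cls entails_eq_sym[OF some_in_cls] assms)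

lemma universe_term_model: "universe (term_model n \<gamma>) = cls n \<gamma> ` {s. wf_trm n s}"
  by (simp add: term_model_def)

lemma MV_entails:
  assumes "Sequent m Tru \<phi> \<in> MV" "wf_form \<gamma> n" "\<And>i. i < m \<Longrightarrow> wf_trm n (\<sigma> i)"
  shows "\<gamma> \<turnstile>\<^bsub>n\<^esub> subst \<phi> \<sigma>"
proof (rule true_entails_subst)
  show "Tru \<turnstile>\<^bsub>m\<^esub> \<phi>" using assms(1) MV_subset by (intro axiom) (auto simp: MV_def Let_def)
qed (use assms in auto)

lemma mv_algebra_term_model:
  assumes "wf_form \<gamma> n" shows "mv_algebra (term_model n \<gamma>)"
proof -
  let ?M = "term_model n \<gamma>" and ?\<sigma> = "\<lambda>s t u. case_nat s (case_nat t (\<lambda>_. u))"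
  have ax: "cls n \<gamma> (subst_trm (?\<sigma> s t u) l) = cls n \<gamma> (subst_trm (?\<sigma> s t u) r)"
    if "Sequent m Tru (Eq l r) \<in> (MV :: 'j sequent set)" "wf_trm n s" "wf_trm n t" "wf_trm n u" for m s t u l r
    using MV_entails[OF that(1) assms, of "?\<sigma> s t u"] that(2-4)
    by (auto intro!: cls_eqI split: nat.split)
  have laws: "cls n \<gamma> (Plus (Plus s t) u) = cls n \<gamma> (Plus s (Plus t u))"
    "cls n \<gamma> (Plus s t) = cls n \<gamma> (Plus t s)"
    "cls n \<gamma> (Plus s Zero) = cls n \<gamma> s"
    "cls n \<gamma> (Neg (Neg s)) = cls n \<gamma> s"
    "cls n \<gamma> (Plus s One) = cls n \<gamma> One"
    "cls n \<gamma> (Plus (Neg (Plus (Neg s) t)) t) = cls n \<gamma> (Plus (Neg (Plus (Neg t) s)) s)"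
    if wf: "wf_trm n s" "wf_trm n t" "wf_trm n u" for s t u
    using ax[OF _ wf, of 3 "Plus (Var 0) (Plus (Var 1) (Var 2))" "Plus (Plus (Var 0) (Var 1)) (Var 2)"]
      ax[OF _ wf, of 2 "Plus (Var 0) (Var 1)" "Plus (Var 1) (Var 0)"]
      ax[OF _ wf, of 1 "Plus (Var 0) Zero" "Var 0"]
      ax[OF _ wf, of 1 "Neg (Neg (Var 0))" "Var 0"]
      ax[OF _ wf, of 1 "Plus (Var 0) One" One]
      ax[OF _ wf, of 2 "Plus (Neg (Plus (Neg (Var 0)) (Var 1))) (Var 1)"
        "Plus (Neg (Plus (Neg (Var 1)) (Var 0))) (Var 0)"]
    by (simp_all add: MV_def Let_def numeral_2_eq_2)
  show ?thesis
  proof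
    fix X Y Z assume "X \<in> universe ?M" "Y \<in> universe ?M" "Z \<in> universe ?M"
    then obtain s t u where *: "X = cls n \<gamma> s" "Y = cls n \<gamma> t" "Z = cls n \<gamma> u"
      and wf: "wf_trm n s" "wf_trm n t" "wf_trm n u"
      by (auto simp: universe_term_model)
    note simps = * term_model_simps[OF assms] wf laws(1)[OF wf]
    show "mv_plus ?M (mv_plus ?M X Y) Z = mv_plus ?M X (mv_plus ?M Y Z)" by (simp add: simps)
  next
    fix X Y assume "X \<in> universe ?M" "Y \<in> universe ?M"
    then obtain s t where *: "X = cls n \<gamma> s" "Y = cls n \<gamma> t" and wf: "wf_trm n s" "wf_trm n t"
      by (auto simp: universe_term_model)
    note simps = * term_model_simps[OF assms] wf
    show "mv_plus ?M X Y \<in> universe ?M" by (simp add: simps)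
    show "mv_plus ?M X Y = mv_plus ?M Y X" using laws(2)[OF wf wf(1)] by (simp add: * term_model_simps[OF assms] wf)
    show "mv_plus ?M (mv_neg ?M (mv_plus ?M (mv_neg ?M X) Y)) Y =
      mv_plus ?M (mv_neg ?M (mv_plus ?M (mv_neg ?M Y) X)) X"
      using laws(6)[OF wf wf(1)] by (simp add: * term_model_simps[OF assms] wf)
  next
    fix X assume "X \<in> universe ?M"
    then obtain s where *: "X = cls n \<gamma> s" and wf: "wf_trm n s"
      by (auto simp: universe_term_model)
    note simps = * term_model_simps[OF assms] wf laws(3-5)[OF wf wf wf]
    show "mv_neg ?M X \<in> universe ?M" by (simp add: simps)
    show "mv_plus ?M X (mv_zero ?M) = X" by (simp add: simps)
    show "mv_neg ?M (mv_neg ?M X) = X" by (simp add: simps)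
    show "mv_plus ?M X (mv_neg ?M (mv_zero ?M)) = mv_neg ?M (mv_zero ?M)" by (simp add: simps)
  qed (simp add: term_model_simps[OF assms])
qed

lemma eval_term_model:
  assumes "wf_form \<gamma> n" "wf_trm m s" "\<And>i. i < m \<Longrightarrow> wf_trm n (\<sigma> i)" "\<And>i. i < m \<Longrightarrow> e i = cls n \<gamma> (\<sigma> i)"
  shows "eval_trm (term_model n \<gamma>) e s = cls n \<gamma> (subst_trm \<sigma> s)"
  using assms(2)
  by (induction s) (auto simp: assms term_model_simps wf_subst_trm)

text \<open>
  Truth in the term model exhibits disjuncts and witnesses, so it can be turned into a derivation.  The
  converse fails: a derivable disjunction need not have a derivable disjunct, which is why \<open>locally\<close> is
  needed below.
\<close>
lemma sat_term_model_imp_entails: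
  assumes "wf_form \<gamma> n" "wf_form \<phi> m" "\<And>i. i < m \<Longrightarrow> wf_trm n (\<sigma> i)"
    "\<And>i. i < m \<Longrightarrow> e i = cls n \<gamma> (\<sigma> i)" "sat (term_model n \<gamma>) \<phi> e"
  shows "\<gamma> \<turnstile>\<^bsub>n\<^esub> subst \<phi> \<sigma>"
  using assms(2-)
proof (induction \<phi> arbitrary: m \<sigma> e)
  case (Eq s t)
  then show ?case
    using eval_term_model[OF assms(1), of m _ \<sigma> e] cls_eq_iff[OF assms(1)] wf_subst_trm[of m _ n \<sigma>]
    by simp
next
  case Tru
  then show ?case using truth[OF assms(1)] by simp
next
  case (And \<phi> \<psi>)
  then show ?case using And.IH[of m \<sigma> e] by (auto intro: and_right)
next
  case (Disj I F)
  then obtain i where i: "i \<in> I" "sat (term_model n \<gamma>) (F i) e" by auto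
  have "\<gamma> \<turnstile>\<^bsub>n\<^esub> subst (F i) \<sigma>"
    by (rule Disj.IH[OF rangeI, of i m \<sigma> e]) (use Disj.prems i in auto)
  moreover have "wf_form (subst (Disj I F) \<sigma>) n" using Disj.prems(1,2) by (rule wf_subst)
  then have "subst (F i) \<sigma> \<turnstile>\<^bsub>n\<^esub> subst (Disj I F) \<sigma>" 
    using disj_right[of I "\<lambda>i. subst (F i) \<sigma>" n i] i by simp
  ultimately show ?case by (rule cut)
next
  case (Ex \<phi>)
  then obtain t where t: "wf_trm n t" "sat (term_model n \<gamma>) \<phi> (case_nat (cls n \<gamma> t) e)"
    by (auto simp: universe_term_model)
  have "\<gamma> \<turnstile>\<^bsub>n\<^esub> subst \<phi> (case_nat t \<sigma>)"
    by (rule Ex.IH[of "Suc m" _ "case_nat (cls n \<gamma> t) e"])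
      (use Ex.prems t in \<open>auto split: nat.split\<close>)
  moreover have "(\<lambda>i. subst_trm (case_nat t Var) (under_binder \<sigma> i)) = case_nat t \<sigma>"
    by (rule ext) (simp add: under_binder_def split: nat.split)
  ultimately have "\<gamma> \<turnstile>\<^bsub>n\<^esub> subst (subst \<phi> (under_binder \<sigma>)) (case_nat t Var)" by simp
  moreover have "wf_form (subst \<phi> (under_binder \<sigma>)) (Suc n)"
    by (rule wf_subst[of _ "Suc m"]) (use Ex.prems wf_under_binder[of m n \<sigma>] in auto)
  ultimately show ?case using t(1) entails_exI by simp
qed

lemma cls_multiple:
  assumes "wf_form \<gamma> n" "wf_trm n a"
  shows "cls n \<gamma> (multiple t a) = mult (term_model n \<gamma>) t (cls n \<gamma> a)"
proof -
  have "eval_trm (term_model n \<gamma>) (\<lambda>_. cls n \<gamma> a) (multiple t (Var 0)) = cls n \<gamma> (multiple t a)"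
    using eval_term_model[OF assms(1), of 1 "multiple t (Var 0)" "\<lambda>_. a"] assms(2) wf_multiple by simp
  then show ?thesis
    using eval_multiple[OF mv_algebra_term_model[OF assms(1)], of "\<lambda>_. cls n \<gamma> a" "Var 0"] assms
    by (simp add: term_model_simps)
qed


section \<open>Local truth\<close>

text \<open>
  A hypothesis \<open>\<delta>\<close> in the context \<open>m\<close> that implies \<open>\<gamma>\<close> after reading its variables as the terms \<open>\<tau>\<close>: a
  morphism to \<open>\<gamma>\<close> in the syntactic category.
\<close>
definition extends :: "nat \<Rightarrow> 'j form \<Rightarrow> nat \<Rightarrow> 'j form \<Rightarrow> (nat \<Rightarrow> trm) \<Rightarrow> bool" where
  "extends n \<gamma> m \<delta> \<tau> \<longleftrightarrow> wf_form \<gamma> n \<and> (\<forall>i<n. wf_trm m (\<tau> i)) \<and> \<delta> \<turnstile>\<^bsub>m\<^esub> subst \<gamma> \<tau>"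

lemma extends_wf: "extends n \<gamma> m \<delta> \<tau> \<Longrightarrow> wf_form \<delta> m"
  unfolding extends_def using entails_wf by blast

lemma extends_wf_trm: "extends n \<gamma> m \<delta> \<tau> \<Longrightarrow> wf_trm n s \<Longrightarrow> wf_trm m (subst_trm \<tau> s)"
  unfolding extends_def by (auto intro: wf_subst_trm)

lemma extends_wf_form: "extends n \<gamma> m \<delta> \<tau> \<Longrightarrow> wf_form \<phi> n \<Longrightarrow> wf_form (subst \<phi> \<tau>) m"
  unfolding extends_def by (auto intro: wf_subst)

lemma extends_entails:
  assumes "extends n \<gamma> m \<delta> \<tau>" "\<gamma> \<turnstile>\<^bsub>n\<^esub> \<phi>" shows "\<delta> \<turnstile>\<^bsub>m\<^esub> subst \<phi> \<tau>"
  using assms substitution[OF assms(2), of m \<tau>] cut unfolding extends_def by blast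

lemma extends_trans:
  assumes "extends n \<gamma> m \<delta> \<tau>" "extends m \<delta> p \<epsilon> \<upsilon>"
  shows "extends n \<gamma> p \<epsilon> (\<lambda>i. subst_trm \<upsilon> (\<tau> i))"
  using assms extends_entails[OF assms(2), of "subst \<gamma> \<tau>"] extends_wf_trm[OF assms(2)]
  unfolding extends_def by simp

lemma term_model_hom:
  assumes ext: "extends n \<gamma> m \<delta> \<tau>"
  shows "\<exists>f. mv_hom (term_model n \<gamma>) (term_model m \<delta>) f
    \<and> (\<forall>s. wf_trm n s \<longrightarrow> f (cls n \<gamma> s) = cls m \<delta> (subst_trm \<tau> s))"
proof -
  define f where "f = (\<lambda>X. cls m \<delta> (subst_trm \<tau> (SOME s. s \<in> X)))"
  have wf: "wf_form \<gamma> n" "wf_form \<delta> m" using ext extends_wf by (auto simp: extends_def)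
  have f: "f (cls n \<gamma> s) = cls m \<delta> (subst_trm \<tau> s)" if "wf_trm n s" for s
    using extends_entails[OF ext some_in_cls[OF wf(1) that]] cls_eqI by (simp add: f_def)
  then have "mv_hom (term_model n \<gamma>) (term_model m \<delta>) f"
    using mv_algebra_term_model wf extends_wf_trm[OF ext]
    by (auto simp: mv_hom_def universe_term_model term_model_simps)
  then show ?thesis using f by blast
qed

lemma spanned_extends:
  assumes "extends n \<gamma> m \<delta> \<tau>" "\<And>i. i < N \<Longrightarrow> wf_trm n (\<sigma> i)"
    "spanned (term_model n \<gamma>) N (\<lambda>i. cls n \<gamma> (\<sigma> i)) P"
  shows "spanned (term_model m \<delta>) N (\<lambda>i. cls m \<delta> (subst_trm \<tau> (\<sigma> i))) P"
proof -
  obtain f where "mv_hom (term_model n \<gamma>) (term_model m \<delta>) f"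
    "\<And>s. wf_trm n s \<Longrightarrow> f (cls n \<gamma> s) = cls m \<delta> (subst_trm \<tau> s)"
    using term_model_hom[OF assms(1)] by blast
  then show ?thesis using assms(2) by (intro spanned_hom[OF _ assms(3)]) auto
qed

text \<open>
  The extensions with \<open>Q\<close> cover \<open>\<gamma>\<close>: every conclusion that is derivable from all of them is derivable
  from \<open>\<gamma>\<close>.  This impredicative form has the advantage that no disjunction over the cases of \<open>Q\<close> has to be
  written down as a formula, so that the index type of disjunctions does not matter.
\<close>
definition locally :: "nat \<Rightarrow> 'j form \<Rightarrow> (nat \<Rightarrow> 'j form \<Rightarrow> (nat \<Rightarrow> trm) \<Rightarrow> bool) \<Rightarrow> bool" where
  "locally n \<gamma> Q \<longleftrightarrow> (\<forall>\<chi>. wf_form \<chi> n \<longrightarrow>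
    (\<forall>m \<delta> \<tau>. extends n \<gamma> m \<delta> \<tau> \<longrightarrow> Q m \<delta> \<tau> \<longrightarrow> \<delta> \<turnstile>\<^bsub>m\<^esub> subst \<chi> \<tau>) \<longrightarrow> \<gamma> \<turnstile>\<^bsub>n\<^esub> \<chi>)"

lemma locallyD:
  assumes "locally n \<gamma> Q" "wf_form \<chi> n"
    "\<And>m \<delta> \<tau>. extends n \<gamma> m \<delta> \<tau> \<Longrightarrow> Q m \<delta> \<tau> \<Longrightarrow> \<delta> \<turnstile>\<^bsub>m\<^esub> subst \<chi> \<tau>"
  shows "\<gamma> \<turnstile>\<^bsub>n\<^esub> \<chi>"
  using assms unfolding locally_def by blast

lemma extends_refl: "wf_form \<gamma> n \<Longrightarrow> extends n \<gamma> n \<gamma> Var"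
  by (simp add: extends_def identity)

lemma locally_now: "wf_form \<gamma> n \<Longrightarrow> Q n \<gamma> Var \<Longrightarrow> locally n \<gamma> Q"
  unfolding locally_def using extends_refl[of \<gamma> n] by (metis subst_Var)

text \<open>
  Transitivity of coverings.
\<close>
lemma locally_bind:
  assumes "locally n \<gamma> Q"
    and "\<And>m \<delta> \<tau>. extends n \<gamma> m \<delta> \<tau> \<Longrightarrow> Q m \<delta> \<tau> \<Longrightarrow>
      locally m \<delta> (\<lambda>p \<epsilon> \<upsilon>. R p \<epsilon> (\<lambda>i. subst_trm \<upsilon> (\<tau> i)))"
  shows "locally n \<gamma> R"
  unfolding locally_def
proof (intro allI impI)
  fix \<chi> assume \<chi>: "wf_form \<chi> n"
    and R: "\<forall>m \<delta> \<tau>. extends n \<gamma> m \<delta> \<tau> \<longrightarrow> R m \<delta> \<tau> \<longrightarrow> \<delta> \<turnstile>\<^bsub>m\<^esub> subst \<chi> \<tau>"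
  show "\<gamma> \<turnstile>\<^bsub>n\<^esub> \<chi>"
  proof (rule locallyD[OF assms(1) \<chi>])
    fix m \<delta> \<tau> assume ext: "extends n \<gamma> m \<delta> \<tau>" and "Q m \<delta> \<tau>"
    then have "locally m \<delta> (\<lambda>p \<epsilon> \<upsilon>. R p \<epsilon> (\<lambda>i. subst_trm \<upsilon> (\<tau> i)))" by (rule assms(2))
    then show "\<delta> \<turnstile>\<^bsub>m\<^esub> subst \<chi> \<tau>"
      by (rule locallyD) (use ext \<chi> R extends_wf_form extends_trans in \<open>auto\<close>)
  qed
qed

lemma locally_mono:
  assumes "locally n \<gamma> Q" "\<And>m \<delta> \<tau>. extends n \<gamma> m \<delta> \<tau> \<Longrightarrow> Q m \<delta> \<tau> \<Longrightarrow> R m \<delta> \<tau>"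
  shows "locally n \<gamma> R"
  using assms unfolding locally_def by blast

lemma locally_Disj:
  assumes "\<gamma> \<turnstile>\<^bsub>n\<^esub> Disj I F"
  shows "locally n \<gamma> (\<lambda>m \<delta> \<tau>. \<exists>i\<in>I. \<delta> \<turnstile>\<^bsub>m\<^esub> subst (F i) \<tau>)"
  unfolding locally_def
proof (intro allI impI)
  note wf = entails_wf[OF assms]
  fix \<chi> assume \<chi>: "wf_form \<chi> n" and *: "\<forall>m \<delta> \<tau>. extends n \<gamma> m \<delta> \<tau> \<longrightarrow>
    (\<exists>i\<in>I. \<delta> \<turnstile>\<^bsub>m\<^esub> subst (F i) \<tau>) \<longrightarrow> \<delta> \<turnstile>\<^bsub>m\<^esub> subst \<chi> \<tau>"
  show "\<gamma> \<turnstile>\<^bsub>n\<^esub> \<chi>"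
  proof (rule entails_disjE[OF assms \<chi>])
    fix i assume i: "i \<in> I"
    have "extends n \<gamma> n (And \<gamma> (F i)) Var" "And \<gamma> (F i) \<turnstile>\<^bsub>n\<^esub> subst (F i) Var"
      using wf i by (auto simp: extends_def intro: and_left1 and_left2)
    then have "And \<gamma> (F i) \<turnstile>\<^bsub>n\<^esub> subst \<chi> Var" using * i by blast
    then show "And \<gamma> (F i) \<turnstile>\<^bsub>n\<^esub> \<chi>" by simp
  qed
qed

lemma locally_Ex:
  assumes "\<gamma> \<turnstile>\<^bsub>n\<^esub> Ex \<phi>"
  shows "locally n \<gamma> (\<lambda>m \<delta> \<tau>. \<exists>a. wf_trm m a \<and> \<delta> \<turnstile>\<^bsub>m\<^esub> subst \<phi> (case_nat a \<tau>))"
  unfolding locally_def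
proof (intro allI impI)
  note wf = entails_wf[OF assms]
  fix \<chi> assume \<chi>: "wf_form \<chi> n" and *: "\<forall>m \<delta> \<tau>. extends n \<gamma> m \<delta> \<tau> \<longrightarrow>
    (\<exists>a. wf_trm m a \<and> \<delta> \<turnstile>\<^bsub>m\<^esub> subst \<phi> (case_nat a \<tau>)) \<longrightarrow> \<delta> \<turnstile>\<^bsub>m\<^esub> subst \<chi> \<tau>"
  let ?\<delta> = "And (weaken \<gamma>) \<phi>"
  show "\<gamma> \<turnstile>\<^bsub>n\<^esub> \<chi>"
  proof (rule entails_exE[OF assms \<chi>])
    have wf': "wf_form (weaken \<gamma>) (Suc n)" "wf_form \<phi> (Suc n)" using wf wf_weaken by auto
    have "case_nat (Var 0) (\<lambda>i. Var (Suc i)) = Var" by (rule ext) (simp split: nat.split)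
    then have "?\<delta> \<turnstile>\<^bsub>Suc n\<^esub> subst \<phi> (case_nat (Var 0) (\<lambda>i. Var (Suc i)))"
      using and_left2[OF wf'] by simp
    moreover have "extends n \<gamma> (Suc n) ?\<delta> (\<lambda>i. Var (Suc i))"
      using wf and_left1[OF wf'] by (simp add: extends_def)
    moreover have "wf_trm (Suc n) (Var 0)" by simp
    ultimately show "?\<delta> \<turnstile>\<^bsub>Suc n\<^esub> weaken \<chi>" using * by blast
  qed
qed

end


section \<open>Consequences of the chain axiom\<close>

locale chain_theory = mv_theory T for T :: "((nat \<times> nat) + 'i) sequent set" +
  assumes chain_axiom_in: "chain_axiom \<in> T"
begin

lemma locally_multiple_of_generator:
  assumes \<gamma>: "wf_form \<gamma> n" and s: "wf_trm n s"
  shows "locally n \<gamma> (\<lambda>m \<delta> \<tau>. \<exists>k z t. generator (term_model m \<delta>) k z \<and> 0 < k \<and>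
    cls m \<delta> (subst_trm \<tau> s) = mult (term_model m \<delta>) t z)"
proof -
  define \<beta> :: "nat \<Rightarrow> nat \<Rightarrow> ((nat \<times> nat) + 'i) form" where
    "\<beta> k t = And (\<phi>\<^sub>k k (Var 0)) (Eq (Var 1) (multiple t (Var 0)))" for k t
  define I :: "((nat \<times> nat) + 'i) set" where "I = Inl ` {(k, t). k \<ge> 1}"
  define F :: "(nat \<times> nat) + 'i \<Rightarrow> ((nat \<times> nat) + 'i) form" where
    "F = (\<lambda>i. case i of Inl (k, t) \<Rightarrow> Ex (\<beta> k t) | Inr _ \<Rightarrow> Fls)"
  have eq: "(chain_axiom :: ((nat \<times> nat) + 'i) sequent) = Sequent 1 Tru (Disj I F)"
    unfolding chain_axiom_def I_def F_def \<beta>_def ..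
  have "wf_form (Disj I F) 1"
    by (auto simp: I_def F_def \<beta>_def \<phi>\<^sub>k_def intro: wf_multiple)
  then have "Tru \<turnstile>\<^bsub>1\<^esub> Disj I F" using axiom[OF chain_axiom_in] unfolding eq by simp
  then have "\<gamma> \<turnstile>\<^bsub>n\<^esub> subst (Disj I F) (\<lambda>_. s)" by (rule true_entails_subst) (use \<gamma> s in auto)
  then have "\<gamma> \<turnstile>\<^bsub>n\<^esub> Disj I (\<lambda>i. subst (F i) (\<lambda>_. s))" by simp
  then show ?thesis
  proof (rule locally_bind[OF locally_Disj], elim bexE)
    fix m \<delta> \<tau> i assume ext: "extends n \<gamma> m \<delta> \<tau>" and i: "i \<in> I"
      and "\<delta> \<turnstile>\<^bsub>m\<^esub> subst (subst (F i) (\<lambda>_. s)) \<tau>"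
    moreover obtain k t where k: "i = Inl (k, t)" "k \<ge> 1" using i by (auto simp: I_def)
    ultimately have "\<delta> \<turnstile>\<^bsub>m\<^esub> Ex (subst (\<beta> k t) (under_binder (\<lambda>_. subst_trm \<tau> s)))"
      by (simp add: F_def subst_under_binder)
    then show "locally m \<delta> (\<lambda>p \<epsilon> \<upsilon>. \<exists>k z t. generator (term_model p \<epsilon>) k z \<and> 0 < k \<and>
      cls p \<epsilon> (subst_trm (\<lambda>i. subst_trm \<upsilon> (\<tau> i)) s) = mult (term_model p \<epsilon>) t z)"
    proof (rule locally_mono[OF locally_Ex], elim exE conjE)
      fix p \<epsilon> \<upsilon> a assume ext': "extends m \<delta> p \<epsilon> \<upsilon>" and a: "wf_trm p a"
        and "\<epsilon> \<turnstile>\<^bsub>p\<^esub> subst (subst (\<beta> k t) (under_binder (\<lambda>_. subst_trm \<tau> s))) (case_nat a \<upsilon>)"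
      then have *: "\<epsilon> \<turnstile>\<^bsub>p\<^esub> And (Eq (multiple (k - 1) a) (Neg a))
          (Eq (subst_trm (\<lambda>i. subst_trm \<upsilon> (\<tau> i)) s) (multiple t a))" (is "_ \<turnstile>\<^bsub>_\<^esub> And ?\<phi> ?\<psi>")
        by (simp add: \<beta>_def \<phi>\<^sub>k_def)
      note \<epsilon> = extends_wf[OF ext'] and wf = entails_wf(2)[OF *]
      have "\<epsilon> \<turnstile>\<^bsub>p\<^esub> ?\<phi>" "\<epsilon> \<turnstile>\<^bsub>p\<^esub> ?\<psi>"
        using cut[OF * and_left1] cut[OF * and_left2] wf by simp_all
      then have "generator (term_model p \<epsilon>) k (cls p \<epsilon> a)"
        "cls p \<epsilon> (subst_trm (\<lambda>i. subst_trm \<upsilon> (\<tau> i)) s) = mult (term_model p \<epsilon>) t (cls p \<epsilon> a)"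
        using cls_eqI[where n = p and \<gamma> = \<epsilon>] k(2) a
        by (auto simp: generator_def cls_multiple[OF \<epsilon> a, symmetric] term_model_simps[OF \<epsilon>])
      moreover have "0 < k" using k(2) by simp
      ultimately show "\<exists>k z t. generator (term_model p \<epsilon>) k z \<and> 0 < k \<and>
        cls p \<epsilon> (subst_trm (\<lambda>i. subst_trm \<upsilon> (\<tau> i)) s) = mult (term_model p \<epsilon>) t z"
        by blast
    qed
  qed
qed

lemma locally_spanned:
  assumes "wf_form \<gamma> n" "\<And>i. i < N \<Longrightarrow> wf_trm n (\<sigma> i)"
  shows "locally n \<gamma> (\<lambda>m \<delta> \<tau>.
    spanned (term_model m \<delta>) N (\<lambda>i. cls m \<delta> (subst_trm \<tau> (\<sigma> i))) (\<lambda>k t. 0 < k))"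
  using assms(2)
proof (induction N)
  case 0
  show ?case by (intro locally_now spanned_0 mv_algebra_term_model assms(1))
next
  case (Suc N)
  have "locally n \<gamma> (\<lambda>m \<delta> \<tau>.
    spanned (term_model m \<delta>) N (\<lambda>i. cls m \<delta> (subst_trm \<tau> (\<sigma> i))) (\<lambda>k t. 0 < k))"
    by (rule Suc.IH) (use Suc.prems in auto)
  then show ?case
  proof (rule locally_bind)
    fix m \<delta> \<tau> assume ext: "extends n \<gamma> m \<delta> \<tau>"
      and span: "spanned (term_model m \<delta>) N (\<lambda>i. cls m \<delta> (subst_trm \<tau> (\<sigma> i))) (\<lambda>k t. 0 < k)"
    have wf: "wf_trm m (subst_trm \<tau> (\<sigma> i))" if "i < Suc N" for i
      using extends_wf_trm[OF ext] Suc.prems that by simp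
    show "locally m \<delta> (\<lambda>p \<epsilon> \<upsilon>. spanned (term_model p \<epsilon>) (Suc N)
      (\<lambda>i. cls p \<epsilon> (subst_trm (\<lambda>i. subst_trm \<upsilon> (\<tau> i)) (\<sigma> i))) (\<lambda>k t. 0 < k))"
    proof (rule locally_mono[OF locally_multiple_of_generator[OF extends_wf[OF ext] wf[of N]]],
        simp, elim exE conjE)
      fix p \<epsilon> \<upsilon> k z t assume ext': "extends m \<delta> p \<epsilon> \<upsilon>"
        and *: "generator (term_model p \<epsilon>) k z" "0 < k"
          "cls p \<epsilon> (subst_trm \<upsilon> (subst_trm \<tau> (\<sigma> N))) = mult (term_model p \<epsilon>) t z"
      have "spanned (term_model p \<epsilon>) N (\<lambda>i. cls p \<epsilon> (subst_trm \<upsilon> (subst_trm \<tau> (\<sigma> i)))) (\<lambda>k t. 0 < k)"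
        using spanned_extends[OF ext' _ span] wf by simp
      then show "spanned (term_model p \<epsilon>) (Suc N)
        (\<lambda>i. cls p \<epsilon> (subst_trm (\<lambda>i. subst_trm \<upsilon> (\<tau> i)) (\<sigma> i))) (\<lambda>k t. 0 < k)"
        using spanned_Suc[OF mv_algebra_term_model[OF extends_wf[OF ext']] _ *(1,2)] *(3) by simp
    qed
  qed
qed

text \<open>
  This is the place where derivability in the theory is reduced to truth in chains.  Equations are
  transferred by \<open>spanned_Eq\<close>, and conjunctions by \<open>spanned_And\<close>; disjunctions and quantifiers are
  handled by passing to a covering on which a disjunct or a witness is known.
\<close>
lemma locally_sat_chain:
  assumes "\<gamma> \<turnstile>\<^bsub>n\<^esub> subst \<phi> \<sigma>" "wf_form \<phi> N" "\<And>i. i < N \<Longrightarrow> wf_trm n (\<sigma> i)"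
  shows "locally n \<gamma> (\<lambda>m \<delta> \<tau>.
    spanned (term_model m \<delta>) N (\<lambda>i. cls m \<delta> (subst_trm \<tau> (\<sigma> i))) (\<lambda>k. sat (chain k) \<phi>))"
  using assms
proof (induction \<phi> arbitrary: n \<gamma> \<sigma> N)
  case (Eq r s)
  have \<gamma>: "wf_form \<gamma> n" using Eq.prems entails_wf by blast
  show ?case
  proof (rule locally_mono[OF locally_spanned[OF \<gamma> Eq.prems(3)]])
    fix m \<delta> \<tau> assume ext: "extends n \<gamma> m \<delta> \<tau>"
      and span: "spanned (term_model m \<delta>) N (\<lambda>i. cls m \<delta> (subst_trm \<tau> (\<sigma> i))) (\<lambda>k t. 0 < k)"
    note \<delta> = extends_wf[OF ext]
    have wf: "wf_trm m (subst_trm \<tau> (\<sigma> i))" if "i < N" for i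
      using extends_wf_trm[OF ext] Eq.prems(3) that by simp
    have "\<delta> \<turnstile>\<^bsub>m\<^esub> Eq (subst_trm (\<lambda>i. subst_trm \<tau> (\<sigma> i)) r) (subst_trm (\<lambda>i. subst_trm \<tau> (\<sigma> i)) s)"
      using extends_entails[OF ext Eq.prems(1)] by simp
    then have "eval_trm (term_model m \<delta>) (\<lambda>i. cls m \<delta> (subst_trm \<tau> (\<sigma> i))) r =
      eval_trm (term_model m \<delta>) (\<lambda>i. cls m \<delta> (subst_trm \<tau> (\<sigma> i))) s"
      using eval_term_model[OF \<delta>, of N _ "\<lambda>i. subst_trm \<tau> (\<sigma> i)"] wf Eq.prems(2) cls_eqI by simp
    then show "spanned (term_model m \<delta>) N (\<lambda>i. cls m \<delta> (subst_trm \<tau> (\<sigma> i)))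
      (\<lambda>k. sat (chain k) (Eq r s))"
      using Eq.prems(2) by (intro spanned_Eq[OF mv_algebra_term_model[OF \<delta>]] spanned_mono[OF span]) auto
  qed
next
  case Tru
  have \<gamma>: "wf_form \<gamma> n" using Tru.prems entails_wf by blast
  show ?case
    by (rule locally_mono[OF locally_spanned[OF \<gamma> Tru.prems(3)]]) (auto elim: spanned_mono)
next
  case (And \<phi> \<psi>)
  have wf: "wf_form (subst \<phi> \<sigma>) n" "wf_form (subst \<psi> \<sigma>) n" using entails_wf(2)[OF And.prems(1)] by auto
  have 1: "\<gamma> \<turnstile>\<^bsub>n\<^esub> subst \<phi> \<sigma>" and 2: "\<gamma> \<turnstile>\<^bsub>n\<^esub> subst \<psi> \<sigma>"
    using And.prems(1) cut[OF _ and_left1[OF wf]] cut[OF _ and_left2[OF wf]] by auto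
  have "locally n \<gamma> (\<lambda>m \<delta> \<tau>.
    spanned (term_model m \<delta>) N (\<lambda>i. cls m \<delta> (subst_trm \<tau> (\<sigma> i))) (\<lambda>k. sat (chain k) \<phi>))"
    by (rule And.IH(1)[OF 1]) (use And.prems in auto)
  then show ?case
  proof (rule locally_bind)
    fix m \<delta> \<tau> assume ext: "extends n \<gamma> m \<delta> \<tau>"
      and span: "spanned (term_model m \<delta>) N (\<lambda>i. cls m \<delta> (subst_trm \<tau> (\<sigma> i))) (\<lambda>k. sat (chain k) \<phi>)"
    have wf: "wf_trm m (subst_trm \<tau> (\<sigma> i))" if "i < N" for i
      using extends_wf_trm[OF ext] And.prems(3) that by simp
    have "locally m \<delta> (\<lambda>p \<epsilon> \<upsilon>. spanned (term_model p \<epsilon>) N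
      (\<lambda>i. cls p \<epsilon> (subst_trm \<upsilon> (subst_trm \<tau> (\<sigma> i)))) (\<lambda>k. sat (chain k) \<psi>))"
      by (rule And.IH(2)) (use extends_entails[OF ext 2] And.prems wf in auto)
    then show "locally m \<delta> (\<lambda>p \<epsilon> \<upsilon>. spanned (term_model p \<epsilon>) N
      (\<lambda>i. cls p \<epsilon> (subst_trm (\<lambda>i. subst_trm \<upsilon> (\<tau> i)) (\<sigma> i))) (\<lambda>k. sat (chain k) (And \<phi> \<psi>)))"
    proof (rule locally_mono)
      fix p \<epsilon> \<upsilon> assume ext': "extends m \<delta> p \<epsilon> \<upsilon>"
        and span': "spanned (term_model p \<epsilon>) N
          (\<lambda>i. cls p \<epsilon> (subst_trm \<upsilon> (subst_trm \<tau> (\<sigma> i)))) (\<lambda>k. sat (chain k) \<psi>)"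
      show "spanned (term_model p \<epsilon>) N
        (\<lambda>i. cls p \<epsilon> (subst_trm (\<lambda>i. subst_trm \<upsilon> (\<tau> i)) (\<sigma> i))) (\<lambda>k. sat (chain k) (And \<phi> \<psi>))"
        using spanned_And[OF mv_algebra_term_model[OF extends_wf[OF ext']] _ _
            spanned_extends[OF ext' _ span] span'] wf And.prems(2) by simp
    qed
  qed
next
  case (Disj I F)
  have "\<gamma> \<turnstile>\<^bsub>n\<^esub> Disj I (\<lambda>i. subst (F i) \<sigma>)" using Disj.prems(1) by simp
  then show ?case
  proof (rule locally_bind[OF locally_Disj], elim bexE)
    fix m \<delta> \<tau> i assume ext: "extends n \<gamma> m \<delta> \<tau>" and i: "i \<in> I"
      and F: "\<delta> \<turnstile>\<^bsub>m\<^esub> subst (subst (F i) \<sigma>) \<tau>"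
    have "locally m \<delta> (\<lambda>p \<epsilon> \<upsilon>. spanned (term_model p \<epsilon>) N
      (\<lambda>i. cls p \<epsilon> (subst_trm \<upsilon> (subst_trm \<tau> (\<sigma> i)))) (\<lambda>k. sat (chain k) (F i)))"
      by (rule Disj.IH[OF rangeI]) (use F i Disj.prems extends_wf_trm[OF ext] in auto)
    then show "locally m \<delta> (\<lambda>p \<epsilon> \<upsilon>. spanned (term_model p \<epsilon>) N
      (\<lambda>i. cls p \<epsilon> (subst_trm (\<lambda>i. subst_trm \<upsilon> (\<tau> i)) (\<sigma> i))) (\<lambda>k. sat (chain k) (Disj I F)))"
      by (rule locally_mono) (use i in \<open>auto elim!: spanned_mono\<close>)
  qed
next
  case (Ex \<phi>)
  have "\<gamma> \<turnstile>\<^bsub>n\<^esub> Ex (subst \<phi> (under_binder \<sigma>))" using Ex.prems(1) by simp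
  then show ?case
  proof (rule locally_bind[OF locally_Ex], elim exE conjE)
    fix m \<delta> \<tau> a assume ext: "extends n \<gamma> m \<delta> \<tau>" and a: "wf_trm m a"
      and 1: "\<delta> \<turnstile>\<^bsub>m\<^esub> subst (subst \<phi> (under_binder \<sigma>)) (case_nat a \<tau>)"
    let ?\<sigma> = "case_nat a (\<lambda>i. subst_trm \<tau> (\<sigma> i))"
    have "(\<lambda>i. subst_trm (case_nat a \<tau>) (under_binder \<sigma> i)) = ?\<sigma>"
      by (rule HOL.ext) (simp add: under_binder_def split: nat.split)
    then have "\<delta> \<turnstile>\<^bsub>m\<^esub> subst \<phi> ?\<sigma>" using 1 by simp
    then have "locally m \<delta> (\<lambda>p \<epsilon> \<upsilon>. spanned (term_model p \<epsilon>) (Suc N)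
      (\<lambda>i. cls p \<epsilon> (subst_trm \<upsilon> (?\<sigma> i))) (\<lambda>k. sat (chain k) \<phi>))"
      by (rule Ex.IH)
        (use Ex.prems a extends_wf_trm[OF ext] in \<open>auto simp: less_Suc_eq_0_disj\<close>)
    then show "locally m \<delta> (\<lambda>p \<epsilon> \<upsilon>. spanned (term_model p \<epsilon>) N
      (\<lambda>i. cls p \<epsilon> (subst_trm (\<lambda>i. subst_trm \<upsilon> (\<tau> i)) (\<sigma> i))) (\<lambda>k. sat (chain k) (Ex \<phi>)))"
    proof (rule locally_mono, elim spannedE)
      fix p \<epsilon> \<upsilon> k z t
      assume gen: "generator (term_model p \<epsilon>) k z"
        and t: "\<And>i. i < Suc N \<Longrightarrow> t i \<le> k"
          "\<And>i. i < Suc N \<Longrightarrow> cls p \<epsilon> (subst_trm \<upsilon> (?\<sigma> i)) = mult (term_model p \<epsilon>) (t i) z"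
          "sat (chain k) \<phi> t"
      have "case_nat (t 0) (\<lambda>i. t (Suc i)) = t" by (rule HOL.ext) (simp split: nat.split)
      then have "sat (chain k) (Ex \<phi>) (\<lambda>i. t (Suc i))"
        using t(1)[of 0] t(3) by (auto simp: chain_def intro!: bexI[of _ "t 0"])
      then show "spanned (term_model p \<epsilon>) N
        (\<lambda>i. cls p \<epsilon> (subst_trm (\<lambda>i. subst_trm \<upsilon> (\<tau> i)) (\<sigma> i))) (\<lambda>k. sat (chain k) (Ex \<phi>))"
        using t(1,2)[of "Suc _"] by (intro spannedI[OF gen, where t = "\<lambda>i. t (Suc i)"]) auto
    qed
  qed
qed

text \<open>
  The representing tuple \<open>t\<close> satisfies \<open>\<phi>\<close> in \<open>chain k\<close>, hence \<open>\<psi>\<close>; its image in the term model then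
  satisfies \<open>\<psi>\<close>, which gives a derivation.  If \<open>chain 0\<close> is not among the given chains, the case
  \<open>k = 0\<close> is contradictory.
\<close>
lemma entails_if_chains_satisfy:
  assumes wf: "wf_form \<phi> n" "wf_form \<psi> n"
    and chains: "\<And>k. k \<in> K \<Longrightarrow> satisfies (chain k) (Sequent n \<phi> \<psi>)"
    and K: "{0<..} \<subseteq> K" "0 \<in> K \<or> nontriviality \<in> T"
  shows "\<phi> \<turnstile>\<^bsub>n\<^esub> \<psi>"
proof -
  have "\<phi> \<turnstile>\<^bsub>n\<^esub> subst \<phi> Var" using identity wf by simp
  then have "locally n \<phi> (\<lambda>m \<delta> \<tau>.
    spanned (term_model m \<delta>) n (\<lambda>i. cls m \<delta> (subst_trm \<tau> (Var i))) (\<lambda>k. sat (chain k) \<phi>))"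
    by (rule locally_sat_chain) (use wf in auto)
  then show ?thesis
  proof (rule locallyD[OF _ wf(2)], elim spannedE)
    fix m \<delta> \<tau> k z t
    assume ext: "extends n \<phi> m \<delta> \<tau>" and gen: "generator (term_model m \<delta>) k z"
      and t: "\<And>i. i < n \<Longrightarrow> t i \<le> k"
        "\<And>i. i < n \<Longrightarrow> cls m \<delta> (subst_trm \<tau> (Var i)) = mult (term_model m \<delta>) (t i) z"
        "sat (chain k) \<phi> t"
    note \<delta> = extends_wf[OF ext]
    show "\<delta> \<turnstile>\<^bsub>m\<^esub> subst \<psi> \<tau>"
    proof (cases "k \<in> K")
      case True
      then have "sat (chain k) \<psi> t" using chains[OF True] t by (auto simp: chain_def)
      then have "sat (term_model m \<delta>) \<psi> (\<lambda>i. cls m \<delta> (\<tau> i))"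
        by (rule sat_hom[OF generator_mult_hom[OF mv_algebra_term_model[OF \<delta>] gen] wf(2), rotated 2])
          (use t in \<open>auto simp: chain_def\<close>)
      then show ?thesis
        by (rule sat_term_model_imp_entails[OF \<delta> wf(2), rotated 2])
          (use ext in \<open>auto simp: extends_def\<close>)
    next
      case False
      then have "k = 0" using K(1) by (cases k) auto
      then have k: "k = 0" "nontriviality \<in> T" using False K(2) by auto
      then have "\<delta> \<turnstile>\<^bsub>m\<^esub> Eq Zero One"
        using gen cls_eq_iff[OF \<delta>, of One Zero] \<delta>
        by (simp add: generator_def term_model_simps)
      \<comment> \<open>\<open>nontriviality\<close> has the empty context; substitution moves it to the context \<open>m\<close>.\<close>
      moreover have "Eq Zero One \<turnstile>\<^bsub>0\<^esub> Fls"
        using axiom[OF k(2)] by (simp add: nontriviality_def Fls_def)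
      then have "Eq Zero One \<turnstile>\<^bsub>m\<^esub> Disj {} (\<lambda>_. Tru)"
        using substitution[of T 0 _ _ m \<tau>] by (fastforce simp: Fls_def)
      ultimately have "\<delta> \<turnstile>\<^bsub>m\<^esub> Disj {} (\<lambda>_. Tru)" by (rule cut)
      then show ?thesis by (rule entails_disjE) (use extends_wf_form[OF ext wf(2)] in auto)
    qed
  qed
qed

end


section \<open>Comparison of the theories\<close>

text \<open>
  If \<open>n > 0\<close>, every element is a multiple of \<open>z = 1\<close>, and \<open>k = n\<close>.
\<close>
lemma chain_satisfies_chain_axiom:
  "satisfies (chain n) (chain_axiom :: ((nat \<times> nat) + 'i) sequent)"
proof -
  have m: "mult (chain n) j 1 = min j n" if "0 < n" for j
    using that by (induction j) (auto simp: chain_def)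
  have ev: "eval_trm (chain n) e (multiple t (Var 0)) = mult (chain n) t (e 0)" if "e 0 \<le> n" for e t
    using eval_multiple[OF mv_algebra_chain, of n e "Var 0"] that by (simp add: chain_def)
  have "\<exists>k\<ge>1. \<exists>t. \<exists>z\<le>n. mult (chain n) (k - 1) z = n - z \<and> x = mult (chain n) t z" if "x \<le> n" for x
  proof (cases "n = 0")
    case True
    then show ?thesis using that by (intro exI[of _ 1] exI[of _ 0] conjI) (auto simp: chain_def)
  next
    case False
    then show ?thesis using that m
      by (intro exI[of _ n] exI[of _ x] exI[of _ 1] conjI) auto
  qed
  then show ?thesis
    using ev by (simp add: chain_axiom_def \<phi>\<^sub>k_def) (fastforce simp: chain_def)
qed

lemma same_theorems_theory_of_chains:
  fixes K :: "nat set" and U :: "((nat \<times> nat) + 'i) sequent set"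
  assumes U: "MV \<subseteq> U" "chain_axiom \<in> U"
    and K: "{0<..} \<subseteq> K" "0 \<in> K \<or> nontriviality \<in> U"
    and sound: "\<And>k s. k \<in> K \<Longrightarrow> s \<in> U \<Longrightarrow> satisfies (chain k) s"
  shows "same_theorems (theory_of_chains K) U"
  unfolding same_theorems_def
proof (intro allI impI iffI)
  fix s :: "((nat \<times> nat) + 'i) sequent" assume wf: "wf_sequent s"
  interpret chain_theory U using U by unfold_locales
  have closed: "mv_zero (chain k) \<in> universe (chain k)"
    "\<And>a. a \<in> universe (chain k) \<Longrightarrow> mv_neg (chain k) a \<in> universe (chain k)"
    "\<And>a b. a \<in> universe (chain k) \<Longrightarrow> b \<in> universe (chain k) \<Longrightarrow>
      mv_plus (chain k) a b \<in> universe (chain k)" for k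
    by (auto simp: chain_def)
  {
    assume s: "proves (theory_of_chains K) s"
    have "satisfies (chain k) s" if "k \<in> K" for k
      using s by (rule soundness) (use that closed in \<open>auto simp: theory_of_chains_def\<close>)
    then show "proves U s" 
      using wf entails_if_chains_satisfy[of _ _ _ K] K by (cases s) simp
  next
    assume s: "proves U s"
    have "satisfies (chain k) s" if "k \<in> K" for k
      using s by (rule soundness) (use that closed sound in auto)
    then show "proves (theory_of_chains K) s"
      using wf by (intro axiom) (auto simp: theory_of_chains_def)
  }
qed

theorem theorem9p7:
  shows "same_theorems (theory_of_chains UNIV) (MV \<union> {chain_axiom :: ((nat \<times> nat) + 'i) sequent})
    \<and> same_theorems (theory_of_chains {0<..})
        (MV \<union> {chain_axiom :: ((nat \<times> nat) + 'i) sequent, nontriviality})"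
proof
  note sound = mv_algebra_satisfies_MV[OF mv_algebra_chain] chain_satisfies_chain_axiom
  show "same_theorems (theory_of_chains UNIV) (MV \<union> {chain_axiom :: ((nat \<times> nat) + 'i) sequent})"
    by (rule same_theorems_theory_of_chains) (use sound in auto)
  have "satisfies (chain k) nontriviality" if "0 < k" for k
    using that nontriviality_in_theory by (auto simp: theory_of_chains_def)
  then show "same_theorems (theory_of_chains {0<..})
      (MV \<union> {chain_axiom :: ((nat \<times> nat) + 'i) sequent, nontriviality})"
    by (intro same_theorems_theory_of_chains) (use sound in auto)
qed

end
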